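(* $\mathcal{L}_{\rm V}(\mathbb{RDMP}) \cong \mathcal{L}_{\rm V}(\mathbb{RDMH}) \cong \mathcal{L}_{\rm V}(\mathbb{RDMDBLH}) \cong \mathcal{L}_{\rm V}(\mathbb{RDMDBLP})$ (isomorphism of lattices), where $\mathcal{L}_{\rm V}(\mathbb V)$ denotes the lattice of subvarieties of the variety $\mathbb V$, ordered by inclusion.
   Context: A De Morgan algebra is a bounded distributive lattice with a unary operation ${}'$ satisfying $x''\approx x$, $(x\vee y)'\approx x'\wedge y'$, $(x\wedge y)'\approx x'\vee y'$, $0'\approx1$, $1'\approx0$. All algebras below have a De Morgan algebra reduct $\langle A,\vee,\wedge,{}',0,1\rangle$. Notation for the further operations: $x^*$ is the largest $z$ with $x\wedge z=0$; $x^+$ is the least $z$ with $x\vee z=1$; $x\to y$ is the largest $z$ with $x\wedge z\le y$; $x\leftarrow y$ is the least $z$ with $y\le x\vee z$. Where ${}^*$ is not basic, $x^*:=x\to0$. The regularity identity is (M1): $(x\wedge x'{}^*{}')\vee(y\vee y^* )\approx y\vee y^*$, where $x'{}^*{}'=((x')^* )'$. $\mathbb{RDMP}$ (regular De Morgan p-algebras): algebras $\langle A,\vee,\wedge,{}^*,{}',0,1\rangle$ satisfying (M1). $\mathbb{RDMH}$ (regular De Morgan Heyting algebras): algebras $\langle A,\vee,\wedge,\to,{}',0,1\rangle$ satisfying (M1). $\mathbb{RDMDBLH}$ (regular De Morgan double Heyting algebras): algebras $\langle A,\vee,\wedge,\to,\leftarrow,{}',0,1\rangle$ satisfying (M1).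 $\mathbb{RDMDBLP}$ (regular De Morgan double p-algebras): algebras $\langle A,\vee,\wedge,{}^*,{}^+,{}',0,1\rangle$ satisfying (M1). *)

theory Defs
  imports "HOL-Algebra.Lattice" "HOL-Library.Countable_Set"
begin

section \<open>Algebras, identities and varieties\<close>

text \<open>
  A similarity type is an arity function \<^term>\<open>ar :: 'f \<Rightarrow> nat\<close> on a type of operation symbols.
  The universe of an algebra is a nonempty subset of an ambient type. Values of the operations
  outside the universe, or on lists of the wrong length, are irrelevant.
\<close>

record ('f, 'a) algebra = "'a partial_object" +
  interp :: "'f \<Rightarrow> 'a list \<Rightarrow> 'a"

definition is_algebra :: "('f \<Rightarrow> nat) \<Rightarrow> ('f, 'a) algebra \<Rightarrow> bool" where
  "is_algebra ar A \<longleftrightarrow> carrier A \<noteq> {} \<and>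
     (\<forall>f xs. length xs = ar f \<and> set xs \<subseteq> carrier A \<longrightarrow> interp A f xs \<in> carrier A)"

datatype 'f uterm = Var nat | App 'f "'f uterm list"

fun wf_uterm :: "('f \<Rightarrow> nat) \<Rightarrow> 'f uterm \<Rightarrow> bool" where
  "wf_uterm ar (Var v) \<longleftrightarrow> True"
| "wf_uterm ar (App f ts) \<longleftrightarrow> length ts = ar f \<and> (\<forall>t\<in>set ts. wf_uterm ar t)"

fun uterm_val :: "('f, 'a) algebra \<Rightarrow> (nat \<Rightarrow> 'a) \<Rightarrow> 'f uterm \<Rightarrow> 'a" where
  "uterm_val A \<sigma> (Var v) = \<sigma> v"
| "uterm_val A \<sigma> (App f ts) = interp A f (map (uterm_val A \<sigma>) ts)"

type_synonym 'f identity = "'f uterm \<times> 'f uterm"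

definition identities :: "('f \<Rightarrow> nat) \<Rightarrow> 'f identity set" where
  "identities ar = {(s, t). wf_uterm ar s \<and> wf_uterm ar t}"

definition satisfies :: "('f, 'a) algebra \<Rightarrow> 'f identity \<Rightarrow> bool" where
  "satisfies A e \<longleftrightarrow>
     (\<forall>\<sigma>. range \<sigma> \<subseteq> carrier A \<longrightarrow> uterm_val A \<sigma> (fst e) = uterm_val A \<sigma> (snd e))"

definition models :: "('f \<Rightarrow> nat) \<Rightarrow> 'f identity set \<Rightarrow> ('f, 'a) algebra set" where
  "models ar E = {A. is_algebra ar A \<and> (\<forall>e\<in>E. satisfies A e)}"

definition variety :: "('f \<Rightarrow> nat) \<Rightarrow> ('f, 'a) algebra set \<Rightarrow> bool" where
  "variety ar K \<longleftrightarrow> (\<exists>E \<subseteq> identities ar. K = models ar E)"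

definition subvariety_lattice ::
  "('f \<Rightarrow> nat) \<Rightarrow> ('f, 'a) algebra set \<Rightarrow> ('f, 'a) algebra set gorder" where
  "subvariety_lattice ar V =
     \<lparr>carrier = {K. variety ar K \<and> K \<subseteq> V}, eq = (=), le = (\<subseteq>)\<rparr>"

text \<open>\<^const>\<open>join_pres\<close> and \<^const>\<open>meet_pres\<close> include that both structures are lattices.\<close>

definition lattice_isomorphic ::
  "('a, 'c) gorder_scheme \<Rightarrow> ('b, 'd) gorder_scheme \<Rightarrow> bool" where
  "lattice_isomorphic L M \<longleftrightarrow>
     (\<exists>h. bij_betw h (carrier L) (carrier M) \<and> join_pres L M h \<and> meet_pres L M h)"

text \<open>
  Varieties are proper classes, whereas \<^const>\<open>variety\<close> speaks about the algebras whose universe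
  lies in a fixed type. For countably many operation symbols and an infinite ambient type nothing
  is lost: inclusion between the model classes in one infinite type entails inclusion in every
  type, so the order of subvarieties does not depend on the ambient type.
\<close>

lemma uterm_val_cong:
  assumes "\<And>f xs. length xs = ar f \<Longrightarrow> set xs \<subseteq> S \<Longrightarrow>
             g (interp A f xs) = interp B f (map g xs) \<and> interp A f xs \<in> S"
    and "range \<sigma> \<subseteq> S" and "wf_uterm ar t"
  shows "g (uterm_val A \<sigma> t) = uterm_val B (\<lambda>n. g (\<sigma> n)) t \<and> uterm_val A \<sigma> t \<in> S"
  using assms(3)
proof (induction t)
  case (Var v)
  then show ?case using assms(2) by auto
next
  case (App f ts)
  have "length (map (uterm_val A \<sigma>) ts) = ar f" "set (map (uterm_val A \<sigma>) ts) \<subseteq> S"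
    using App by auto
  moreover have "map g (map (uterm_val A \<sigma>) ts) = map (uterm_val B (\<lambda>n. g (\<sigma> n))) ts"
    using App by simp
  ultimately show ?case using assms(1)[of "map (uterm_val A \<sigma>) ts" f]
    by (simp del: map_map)
qed

instance uterm :: (countable) countable
  by countable_datatype

lemma models_subset_transfer:
  fixes E F :: "('f :: countable) identity set"
  assumes "infinite (UNIV :: 'a set)" and "E \<subseteq> identities ar" and "F \<subseteq> identities ar"
    and sub: "(models ar E :: ('f, 'a) algebra set) \<subseteq> models ar F"
  shows "(models ar E :: ('f, 'b) algebra set) \<subseteq> models ar F"
proof
  fix B :: "('f, 'b) algebra"
  assume B: "B \<in> models ar E"
  then have alg: "is_algebra ar B" by (simp add: models_def)
  have "satisfies B e" if e: "e \<in> F" for e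
    unfolding satisfies_def
  proof (intro allI impI)
    fix \<sigma> :: "nat \<Rightarrow> 'b" assume \<sigma>: "range \<sigma> \<subseteq> carrier B"
    define C where "C = uterm_val B \<sigma> ` {t. wf_uterm ar t}"
    have cC: "countable C" unfolding C_def by simp
    have rC: "range \<sigma> \<subseteq> C"
      unfolding C_def by (auto intro!: image_eqI[where x = "Var _"])
    have closed: "interp B f xs \<in> C" if l: "length xs = ar f" and "set xs \<subseteq> C" for f xs
    proof -
      have "\<forall>x\<in>set xs. \<exists>t. wf_uterm ar t \<and> x = uterm_val B \<sigma> t"
        using that(2) unfolding C_def by auto
      then obtain T where T: "\<forall>x\<in>set xs. wf_uterm ar (T x) \<and> x = uterm_val B \<sigma> (T x)"
        by metis
      then have "map (uterm_val B \<sigma>) (map T xs) = xs" by (simp add: map_idI)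
      then have "interp B f xs = uterm_val B \<sigma> (App f (map T xs))" by simp
      moreover have "wf_uterm ar (App f (map T xs))" using T l by auto
      ultimately show ?thesis unfolding C_def by blast
    qed
    have CB: "C \<subseteq> carrier B"
    proof -
      have "uterm_val B \<sigma> t \<in> carrier B" if "wf_uterm ar t" for t
        by (rule uterm_val_cong[where A = B and B = B and g = "\<lambda>x. x", THEN conjunct2, OF _ \<sigma> that])
          (use alg in \<open>simp add: is_algebra_def\<close>)
      then show ?thesis unfolding C_def by auto
    qed
    obtain g :: "'b \<Rightarrow> 'a" where g: "inj_on g C"
    proof -
      obtain h :: "nat \<Rightarrow> 'a" where "inj h"
        using assms(1) infinite_countable_subset by blast
      moreover obtain k :: "'b \<Rightarrow> nat" where "inj_on k C" using cC by (auto simp: countable_def)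
      ultimately have "inj_on (h \<circ> k) C" by (meson comp_inj_on inj_on_subset subset_UNIV)
      then show ?thesis using that by blast
    qed
    define h where "h = the_inv_into C g"
    have hg: "h (g x) = x" if "x \<in> C" for x
      using g that unfolding h_def by (rule the_inv_into_f_f)
    define A where "A = \<lparr>carrier = g ` C, interp = \<lambda>f xs. g (interp B f (map h xs))\<rparr>"
    have h_sub: "set (map h xs) \<subseteq> C" if "set xs \<subseteq> carrier A" for xs
      using that hg by (auto simp: A_def)
    have homA: "h (interp A f xs) = interp B f (map h xs) \<and> interp A f xs \<in> carrier A"
      if "length xs = ar f" "set xs \<subseteq> carrier A" for f xs
      using closed[of "map h xs" f] h_sub[OF that(2)] that(1) hg by (simp add: A_def)
    have algA: "is_algebra ar A"
      using homA rC by (auto simp: is_algebra_def A_def)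
    have valA: "h (uterm_val A \<tau> t) = uterm_val B (\<lambda>n. h (\<tau> n)) t \<and> uterm_val A \<tau> t \<in> carrier A"
      if "range \<tau> \<subseteq> carrier A" "wf_uterm ar t" for \<tau> t
      using homA that by (rule uterm_val_cong)
    have inj_h: "inj_on h (carrier A)"
      using hg by (auto simp: A_def inj_on_def)
    have wf: "wf_uterm ar (fst d) \<and> wf_uterm ar (snd d)" if "d \<in> E \<union> F" for d
      using that assms(2,3) by (auto simp: identities_def)
    have "satisfies A d" if d: "d \<in> E" for d
      unfolding satisfies_def
    proof (intro allI impI)
      fix \<tau> :: "nat \<Rightarrow> 'a" assume \<tau>: "range \<tau> \<subseteq> carrier A"
      have "h y \<in> carrier B" if "y \<in> carrier A" for y
        using that CB hg by (auto simp: A_def)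
      then have "range (\<lambda>n. h (\<tau> n)) \<subseteq> carrier B"
        using \<tau> by blast
      then have "uterm_val B (\<lambda>n. h (\<tau> n)) (fst d) = uterm_val B (\<lambda>n. h (\<tau> n)) (snd d)"
        using B d by (simp add: models_def satisfies_def)
      then show "uterm_val A \<tau> (fst d) = uterm_val A \<tau> (snd d)"
        using valA[OF \<tau>, of "fst d"] valA[OF \<tau>, of "snd d"] wf[of d] d
        by (intro inj_onD[OF inj_h]) simp_all
    qed
    then have "A \<in> models ar F" using sub algA by (auto simp: models_def)
    then have sat: "satisfies A e" using e by (simp add: models_def)
    have r: "range (\<lambda>n. g (\<sigma> n)) \<subseteq> carrier A" using rC by (auto simp: A_def)
    have "(\<lambda>n. h (g (\<sigma> n))) = \<sigma>" using hg rC by (auto simp: fun_eq_iff)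
    moreover have "uterm_val A (\<lambda>n. g (\<sigma> n)) (fst e) = uterm_val A (\<lambda>n. g (\<sigma> n)) (snd e)"
      using sat r by (simp add: satisfies_def)
    ultimately show "uterm_val B \<sigma> (fst e) = uterm_val B \<sigma> (snd e)"
      using valA[OF r, of "fst e"] valA[OF r, of "snd e"] wf[of e] e by simp
  qed
  then show "B \<in> models ar F" using alg by (simp add: models_def)
qed


section \<open>Algebras with a De Morgan algebra reduct\<close>

text \<open>The type parameter supplies the operation symbols beyond those of De Morgan algebras.\<close>

datatype 'e dm_op = Join | Meet | Neg | Zero | One | Op 'e

fun dm_arity :: "('e \<Rightarrow> nat) \<Rightarrow> 'e dm_op \<Rightarrow> nat" where
  "dm_arity ar Join = 2"
| "dm_arity ar Meet = 2"
| "dm_arity ar Neg = 1"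
| "dm_arity ar Zero = 0"
| "dm_arity ar One = 0"
| "dm_arity ar (Op e) = ar e"

definition jn :: "('e dm_op, 'a) algebra \<Rightarrow> 'a \<Rightarrow> 'a \<Rightarrow> 'a" where
  "jn A x y = interp A Join [x, y]"

definition mt :: "('e dm_op, 'a) algebra \<Rightarrow> 'a \<Rightarrow> 'a \<Rightarrow> 'a" where
  "mt A x y = interp A Meet [x, y]"

definition ng :: "('e dm_op, 'a) algebra \<Rightarrow> 'a \<Rightarrow> 'a" where
  "ng A x = interp A Neg [x]"

definition zr :: "('e dm_op, 'a) algebra \<Rightarrow> 'a" where
  "zr A = interp A Zero []"

definition un :: "('e dm_op, 'a) algebra \<Rightarrow> 'a" where
  "un A = interp A One []"

definition de_morgan_reduct :: "('e dm_op, 'a) algebra \<Rightarrow> bool" where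
  "de_morgan_reduct A \<longleftrightarrow>
     (\<forall>x\<in>carrier A. \<forall>y\<in>carrier A.
        jn A x y = jn A y x \<and> mt A x y = mt A y x \<and>
        jn A x (mt A x y) = x \<and> mt A x (jn A x y) = x) \<and>
     (\<forall>x\<in>carrier A. \<forall>y\<in>carrier A. \<forall>z\<in>carrier A.
        jn A x (jn A y z) = jn A (jn A x y) z \<and>
        mt A x (mt A y z) = mt A (mt A x y) z \<and>
        mt A x (jn A y z) = jn A (mt A x y) (mt A x z)) \<and>
     (\<forall>x\<in>carrier A. jn A x (zr A) = x \<and> mt A x (un A) = x) \<and>
     (\<forall>x\<in>carrier A. ng A (ng A x) = x) \<and>
     (\<forall>x\<in>carrier A. \<forall>y\<in>carrier A.
        ng A (jn A x y) = mt A (ng A x) (ng A y) \<and>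
        ng A (mt A x y) = jn A (ng A x) (ng A y)) \<and>
     ng A (zr A) = un A \<and> ng A (un A) = zr A"

definition lattice_order :: "('e dm_op, 'a) algebra \<Rightarrow> 'a gorder" where
  "lattice_order A = \<lparr>carrier = carrier A, eq = (=), le = (\<lambda>x y. mt A x y = x)\<rparr>"

definition is_pcompl :: "('e dm_op, 'a) algebra \<Rightarrow> ('a \<Rightarrow> 'a) \<Rightarrow> bool" where
  "is_pcompl A st \<longleftrightarrow> (\<forall>x\<in>carrier A.
     greatest (lattice_order A) (st x) {z \<in> carrier A. mt A x z = zr A})"

definition is_dual_pcompl :: "('e dm_op, 'a) algebra \<Rightarrow> ('a \<Rightarrow> 'a) \<Rightarrow> bool" where
  "is_dual_pcompl A pl \<longleftrightarrow> (\<forall>x\<in>carrier A.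
     least (lattice_order A) (pl x) {z \<in> carrier A. jn A x z = un A})"

definition is_heyting_imp :: "('e dm_op, 'a) algebra \<Rightarrow> ('a \<Rightarrow> 'a \<Rightarrow> 'a) \<Rightarrow> bool" where
  "is_heyting_imp A im \<longleftrightarrow> (\<forall>x\<in>carrier A. \<forall>y\<in>carrier A.
     greatest (lattice_order A) (im x y)
       {z \<in> carrier A. mt A x z \<sqsubseteq>\<^bsub>lattice_order A\<^esub> y})"

definition is_dual_heyting_imp :: "('e dm_op, 'a) algebra \<Rightarrow> ('a \<Rightarrow> 'a \<Rightarrow> 'a) \<Rightarrow> bool" where
  "is_dual_heyting_imp A cim \<longleftrightarrow> (\<forall>x\<in>carrier A. \<forall>y\<in>carrier A.
     least (lattice_order A) (cim x y)
       {z \<in> carrier A. y \<sqsubseteq>\<^bsub>lattice_order A\<^esub> jn A x z})"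

definition regular :: "('e dm_op, 'a) algebra \<Rightarrow> ('a \<Rightarrow> 'a) \<Rightarrow> bool" where
  "regular A st \<longleftrightarrow> (\<forall>x\<in>carrier A. \<forall>y\<in>carrier A.
     jn A (mt A x (ng A (st (ng A x)))) (jn A y (st y)) = jn A y (st y))"


section \<open>The four varieties\<close>

datatype p_op = Star
datatype h_op = Imp
datatype dblh_op = DImp | DCoimp
datatype dblp_op = DStar | DPlus

definition ar_p :: "p_op dm_op \<Rightarrow> nat" where "ar_p = dm_arity (\<lambda>_. 1)"
definition ar_h :: "h_op dm_op \<Rightarrow> nat" where "ar_h = dm_arity (\<lambda>_. 2)"
definition ar_dblh :: "dblh_op dm_op \<Rightarrow> nat" where "ar_dblh = dm_arity (\<lambda>_. 2)"
definition ar_dblp :: "dblp_op dm_op \<Rightarrow> nat" where "ar_dblp = dm_arity (\<lambda>_. 1)"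

definition RDMP :: "(p_op dm_op, 'a) algebra set" where
  "RDMP = {A. is_algebra ar_p A \<and> de_morgan_reduct A \<and>
     is_pcompl A (\<lambda>x. interp A (Op Star) [x]) \<and>
     regular A (\<lambda>x. interp A (Op Star) [x])}"

definition RDMH :: "(h_op dm_op, 'a) algebra set" where
  "RDMH = {A. is_algebra ar_h A \<and> de_morgan_reduct A \<and>
     is_heyting_imp A (\<lambda>x y. interp A (Op Imp) [x, y]) \<and>
     regular A (\<lambda>x. interp A (Op Imp) [x, zr A])}"

definition RDMDBLH :: "(dblh_op dm_op, 'a) algebra set" where
  "RDMDBLH = {A. is_algebra ar_dblh A \<and> de_morgan_reduct A \<and>
     is_heyting_imp A (\<lambda>x y. interp A (Op DImp) [x, y]) \<and>
     is_dual_heyting_imp A (\<lambda>x y. interp A (Op DCoimp) [x, y]) \<and>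
     regular A (\<lambda>x. interp A (Op DImp) [x, zr A])}"

definition RDMDBLP :: "(dblp_op dm_op, 'a) algebra set" where
  "RDMDBLP = {A. is_algebra ar_dblp A \<and> de_morgan_reduct A \<and>
     is_pcompl A (\<lambda>x. interp A (Op DStar) [x]) \<and>
     is_dual_pcompl A (\<lambda>x. interp A (Op DPlus) [x]) \<and>
     regular A (\<lambda>x. interp A (Op DStar) [x])}"

end

theory Submission
  imports Defs
begin

text \<open>
  All four varieties are term equivalent to regular De Morgan p-algebras, and term equivalent
  varieties have isomorphic lattices of subvarieties, because identities can be translated back and
  forth. The De Morgan negation makes \<open>x'*'\<close> a dual pseudocomplement. In a distributive lattice with
  both pseudocomplements, regularity makes Katrinak's term
  \<open>(x* \<or> y**)** \<and> ((x \<or> x*)+ \<or> x* \<or> y \<or> y*)\<close> a relative pseudocomplement: the first factor gives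
  \<open>x \<and> z \<and> y* = 0\<close>, the second together with \<open>(x \<or> x*) \<and> (x \<or> x*)+ \<le> y \<or> y*\<close> gives
  \<open>x \<and> z \<le> y \<or> y*\<close>, hence \<open>x \<and> z \<le> y\<close>. Its De Morgan dual is the dual implication. Since all these
  operations are determined by the order, each variety is recovered from the reducts.
\<close>

section \<open>Isomorphisms of lattices\<close>

text \<open>All three equivalences start at \<open>RDMP\<close>, which serves as a hub: the
  isomorphisms among the other classes arise by inverting and composing. The hub is also the only
  class with an explicit equational basis, because a class term equivalent to a variety is again a
  variety: its axioms are the translated ones together with identities defining its operations. A
  term reduct keeps the universe, so all classes live in one ambient type. The obstacle is that
  \<open>interp\<close> takes arbitrary values off the universe and on lists of the wrong length, so
  passing to a reduct and back need not return the same record. Equality of algebras is therefore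
  replaced by \<open>agrees\<close>. Uniqueness is what links order and terms: as soon as one
  operation with a given order specification is known, any other meets the specification exactly
  when the two coincide on the universe. In this way the order conditions in the four definitions
  become the equations that a term equivalence demands.\<close>

lemma lattice_isomorphicI:
  assumes "lattice L" "lattice M" and h: "bij_betw h (carrier L) (carrier M)"
    and le: "\<And>x y. x \<in> carrier L \<Longrightarrow> y \<in> carrier L \<Longrightarrow>
               h x \<sqsubseteq>\<^bsub>M\<^esub> h y \<longleftrightarrow> x \<sqsubseteq>\<^bsub>L\<^esub> y"
  shows "lattice_isomorphic L M"
proof -
  interpret L: lattice L by fact
  interpret M: lattice M by fact
  have hC: "h x \<in> carrier M" if "x \<in> carrier L" for x
    using h that by (rule bij_betw_apply)
  have surj: "\<exists>x\<in>carrier L. z = h x" if "z \<in> carrier M" for z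
    using h that by (auto simp: bij_betw_def)
  have "h (x \<squnion>\<^bsub>L\<^esub> y) = h x \<squnion>\<^bsub>M\<^esub> h y" if xy: "x \<in> carrier L" "y \<in> carrier L" for x y
  proof (rule M.le_antisym)
    \<comment> \<open>Only the order is known to be respected by \<open>h\<close>. Surjectivity
      makes the join taken in \<open>M\<close> an image \<open>h z\<close>, and reflecting the order
      turns \<open>z\<close> into an upper bound of \<open>x\<close> and \<open>y\<close> in
      \<open>L\<close>.\<close>
    obtain z where z: "z \<in> carrier L" "h x \<squnion>\<^bsub>M\<^esub> h y = h z"
      using surj[of "h x \<squnion>\<^bsub>M\<^esub> h y"] xy hC by auto
    have "x \<sqsubseteq>\<^bsub>L\<^esub> z" "y \<sqsubseteq>\<^bsub>L\<^esub> z"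
      using M.join_left[of "h x" "h y"] M.join_right[of "h x" "h y"] xy z hC le by auto
    then have "x \<squnion>\<^bsub>L\<^esub> y \<sqsubseteq>\<^bsub>L\<^esub> z" using xy z by (intro L.join_le) auto
    then show "h (x \<squnion>\<^bsub>L\<^esub> y) \<sqsubseteq>\<^bsub>M\<^esub> h x \<squnion>\<^bsub>M\<^esub> h y" using z xy le by simp
    show "h x \<squnion>\<^bsub>M\<^esub> h y \<sqsubseteq>\<^bsub>M\<^esub> h (x \<squnion>\<^bsub>L\<^esub> y)"
      using xy hC le L.join_left L.join_right by (intro M.join_le) auto
  qed (use xy hC in auto)
  moreover have "h (x \<sqinter>\<^bsub>L\<^esub> y) = h x \<sqinter>\<^bsub>M\<^esub> h y" if xy: "x \<in> carrier L" "y \<in> carrier L" for x y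
  proof (rule M.le_antisym)
    obtain z where z: "z \<in> carrier L" "h x \<sqinter>\<^bsub>M\<^esub> h y = h z"
      using surj[of "h x \<sqinter>\<^bsub>M\<^esub> h y"] xy hC by auto
    have "z \<sqsubseteq>\<^bsub>L\<^esub> x" "z \<sqsubseteq>\<^bsub>L\<^esub> y"
      using M.meet_left[of "h x" "h y"] M.meet_right[of "h x" "h y"] xy z hC le by auto
    then have "z \<sqsubseteq>\<^bsub>L\<^esub> x \<sqinter>\<^bsub>L\<^esub> y" using xy z by (intro L.meet_le) auto
    then show "h x \<sqinter>\<^bsub>M\<^esub> h y \<sqsubseteq>\<^bsub>M\<^esub> h (x \<sqinter>\<^bsub>L\<^esub> y)" using z xy le by simp
    show "h (x \<sqinter>\<^bsub>L\<^esub> y) \<sqsubseteq>\<^bsub>M\<^esub> h x \<sqinter>\<^bsub>M\<^esub> h y"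
      using xy hC le L.meet_left L.meet_right by (intro M.meet_le) auto
  qed (use xy hC in auto)
  ultimately show ?thesis
    using assms(1-3) unfolding lattice_isomorphic_def join_pres_def meet_pres_def by blast
qed

lemma lattice_isomorphic_sym:
  assumes "lattice_isomorphic L M"
  shows "lattice_isomorphic M L"
proof -
  obtain h where h: "bij_betw h (carrier L) (carrier M)" "join_pres L M h" "meet_pres L M h"
    using assms by (auto simp: lattice_isomorphic_def)
  interpret L: lattice L using h by (simp add: join_pres_def)
  define g where "g = inv_into (carrier L) h"
  have g: "bij_betw g (carrier M) (carrier L)"
    unfolding g_def using h(1) by (rule bij_betw_inv_into)
  have hg: "h (g x) = x" if "x \<in> carrier M" for x
    using h(1) that unfolding g_def by (rule bij_betw_inv_into_right)
  have gh: "g (h x) = x" if "x \<in> carrier L" for x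
    using h(1) that unfolding g_def by (rule bij_betw_inv_into_left)
  have gC: "g x \<in> carrier L" if "x \<in> carrier M" for x
    using g that by (rule bij_betw_apply)
  have "g (x \<squnion>\<^bsub>M\<^esub> y) = g x \<squnion>\<^bsub>L\<^esub> g y" if "x \<in> carrier M" "y \<in> carrier M" for x y
    using gh[of "g x \<squnion>\<^bsub>L\<^esub> g y"] h(2) that gC hg by (simp add: join_pres_def)
  moreover have "g (x \<sqinter>\<^bsub>M\<^esub> y) = g x \<sqinter>\<^bsub>L\<^esub> g y" if "x \<in> carrier M" "y \<in> carrier M" for x y
    using gh[of "g x \<sqinter>\<^bsub>L\<^esub> g y"] h(3) that gC hg by (simp add: meet_pres_def)
  ultimately show ?thesis
    using g h unfolding lattice_isomorphic_def join_pres_def meet_pres_def by blast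
qed

lemma lattice_isomorphic_trans:
  assumes "lattice_isomorphic L M" and "lattice_isomorphic M N"
  shows "lattice_isomorphic L N"
proof -
  obtain h where h: "bij_betw h (carrier L) (carrier M)" "join_pres L M h" "meet_pres L M h"
    using assms(1) by (auto simp: lattice_isomorphic_def)
  obtain k where k: "bij_betw k (carrier M) (carrier N)" "join_pres M N k" "meet_pres M N k"
    using assms(2) by (auto simp: lattice_isomorphic_def)
  have "h x \<in> carrier M" if "x \<in> carrier L" for x
    using h(1) that by (rule bij_betw_apply)
  then have "join_pres L N (k \<circ> h)" "meet_pres L N (k \<circ> h)"
    using h k by (auto simp: join_pres_def meet_pres_def)
  moreover have "bij_betw (k \<circ> h) (carrier L) (carrier N)"
    using h(1) k(1) by (rule bij_betw_trans)
  ultimately show ?thesis unfolding lattice_isomorphic_def by blast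
qed


section \<open>The lattice of subvarieties\<close>

lemma models_Un: "models ar (E \<union> F) = models ar E \<inter> models ar F"
  by (auto simp: models_def)

lemma variety_Int: "variety ar K \<Longrightarrow> variety ar L \<Longrightarrow> variety ar (K \<inter> L)"
  unfolding variety_def by (metis models_Un Un_least)

lemma variety_is_algebra: "variety ar K \<Longrightarrow> A \<in> K \<Longrightarrow> is_algebra ar A"
  by (auto simp: variety_def models_def)

text \<open>\<open>models ar (theory_of ar K)\<close> is the variety generated by \<open>K\<close>,
  obtained from the equational side rather than through closure under homomorphic images,
  subalgebras and products.\<close>

definition theory_of :: "('f \<Rightarrow> nat) \<Rightarrow> ('f, 'a) algebra set \<Rightarrow> 'f identity set" where
  "theory_of ar K = {e \<in> identities ar. \<forall>A\<in>K. satisfies A e}"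

lemma variety_generated: "variety ar (models ar (theory_of ar K))"
  unfolding variety_def by (rule exI[of _ "theory_of ar K"]) (auto simp: theory_of_def)

lemma subset_generated: "(\<And>A. A \<in> K \<Longrightarrow> is_algebra ar A) \<Longrightarrow> K \<subseteq> models ar (theory_of ar K)"
  by (auto simp: models_def theory_of_def)

lemma generated_least:
  assumes "variety ar L" and "K \<subseteq> L"
  shows "models ar (theory_of ar K) \<subseteq> L"
proof -
  obtain E where "E \<subseteq> identities ar" "L = models ar E"
    using assms(1) by (auto simp: variety_def)
  then show ?thesis using assms(2) by (force simp: models_def theory_of_def)
qed

lemma subvariety_lattice_simps [simp]:
  "carrier (subvariety_lattice ar V) = {K. variety ar K \<and> K \<subseteq> V}"
  "K \<sqsubseteq>\<^bsub>subvariety_lattice ar V\<^esub> L \<longleftrightarrow> K \<subseteq> L"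
  "K .=\<^bsub>subvariety_lattice ar V\<^esub> L \<longleftrightarrow> K = L"
  by (simp_all add: subvariety_lattice_def)

text \<open>Unions of varieties need not be varieties, so the join is the variety generated by the
  union; it stays inside \<open>V\<close> because \<open>V\<close> is itself a variety containing
  both. Meets are intersections, axiomatised by the union of the identity sets.\<close>

lemma lattice_subvariety_lattice:
  assumes V: "variety ar V"
  shows "lattice (subvariety_lattice ar V)"
proof -
  let ?L = "subvariety_lattice ar V"
  have "partial_order ?L"
    by unfold_locales (auto simp: fun_eq_iff)
  moreover have "\<exists>S. least ?L S (Upper ?L {K, M})"
    if "K \<in> carrier ?L" "M \<in> carrier ?L" for K M
  proof -
    let ?S = "models ar (theory_of ar (K \<union> M))"
    have "K \<union> M \<subseteq> ?S"
      using that by (intro subset_generated) (auto intro: variety_is_algebra)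
    moreover have "?S \<subseteq> L" if "variety ar L" "K \<subseteq> L" "M \<subseteq> L" for L
      using that by (intro generated_least) auto
    ultimately have "least ?L ?S (Upper ?L {K, M})"
      using that V variety_generated[of ar "K \<union> M"] by (auto simp: least_def Upper_def)
    then show ?thesis ..
  qed
  moreover have "\<exists>S. greatest ?L S (Lower ?L {K, M})"
    if "K \<in> carrier ?L" "M \<in> carrier ?L" for K M
  proof -
    have "greatest ?L (K \<inter> M) (Lower ?L {K, M})"
      using that by (auto simp: greatest_def Lower_def intro: variety_Int)
    then show ?thesis ..
  qed
  ultimately show ?thesis
    by (intro lattice.intro upper_semilattice.intro lower_semilattice.intro
        upper_semilattice_axioms.intro lower_semilattice_axioms.intro)
qed


section \<open>Algebras that agree on the universe\<close>

definition agrees :: "('f \<Rightarrow> nat) \<Rightarrow> ('f, 'a) algebra \<Rightarrow> ('f, 'a) algebra \<Rightarrow> bool" where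
  "agrees ar A B \<longleftrightarrow> carrier A = carrier B \<and>
     (\<forall>f xs. length xs = ar f \<and> set xs \<subseteq> carrier A \<longrightarrow> interp A f xs = interp B f xs)"

lemma agrees_sym: "agrees ar A B \<Longrightarrow> agrees ar B A"
  by (auto simp: agrees_def)

lemma agrees_uterm_val:
  assumes "agrees ar A B" "is_algebra ar A" "range \<sigma> \<subseteq> carrier A" "wf_uterm ar t"
  shows "uterm_val A \<sigma> t = uterm_val B \<sigma> t"
  using uterm_val_cong[of ar "carrier A" "\<lambda>x. x" A B \<sigma> t] assms
  by (auto simp: agrees_def is_algebra_def)

text \<open>Evaluating a well-formed term under a valuation in the universe never leaves the
  universe, so identities cannot tell \<open>A\<close> from \<open>B\<close>.\<close>

lemma agrees_in_variety:
  assumes K: "variety ar K" and A: "A \<in> K" and AB: "agrees ar A B"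
  shows "B \<in> K"
proof -
  obtain E where E: "E \<subseteq> identities ar" "K = models ar E"
    using K by (auto simp: variety_def)
  have alg: "is_algebra ar A" using A E by (simp add: models_def)
  then have "is_algebra ar B" using AB by (auto simp: is_algebra_def agrees_def)
  moreover have "satisfies B e" if e: "e \<in> E" for e
  proof -
    have wf: "wf_uterm ar (fst e)" "wf_uterm ar (snd e)"
      using e E(1) by (auto simp: identities_def)
    have "satisfies A e" using A E e by (simp add: models_def)
    then show ?thesis
      using agrees_uterm_val[OF AB alg _ wf(1)] agrees_uterm_val[OF AB alg _ wf(2)] AB
      by (simp add: satisfies_def agrees_def)
  qed
  ultimately show ?thesis using E by (simp add: models_def)
qed


section \<open>Term reducts\<close>

fun uvars :: "'f uterm \<Rightarrow> nat set" where
  "uvars (Var v) = {v}"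
| "uvars (App f ts) = (\<Union>t\<in>set ts. uvars t)"

fun subst :: "(nat \<Rightarrow> 'f uterm) \<Rightarrow> 'f uterm \<Rightarrow> 'f uterm" where
  "subst s (Var v) = s v"
| "subst s (App f ts) = App f (map (subst s) ts)"

lemma uterm_val_subst: "uterm_val A \<sigma> (subst s t) = uterm_val A (\<lambda>n. uterm_val A \<sigma> (s n)) t"
proof (induction t)
  case (App f ts)
  then show ?case by (auto intro!: arg_cong[where f = "interp A f"])
qed simp

lemma uterm_val_cong_uvars:
  "(\<And>v. v \<in> uvars t \<Longrightarrow> \<sigma> v = \<sigma>' v) \<Longrightarrow> uterm_val A \<sigma> t = uterm_val A \<sigma>' t"
proof (induction t)
  case (App f ts)
  then have "map (uterm_val A \<sigma>) ts = map (uterm_val A \<sigma>') ts" by auto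
  then show ?case by (simp only: uterm_val.simps)
qed simp

lemma wf_uterm_subst:
  "wf_uterm ar t \<Longrightarrow> (\<And>v. v \<in> uvars t \<Longrightarrow> wf_uterm ar (s v)) \<Longrightarrow> wf_uterm ar (subst s t)"
  by (induction t) auto

text \<open>The valuation is constrained only on the variables of \<open>t\<close> because it will
  be \<open>(!) xs\<close>, which is unspecified beyond the end of \<open>xs\<close>.\<close>

lemma uterm_val_closed:
  assumes "is_algebra ar A"
  shows "wf_uterm ar t \<Longrightarrow> (\<And>v. v \<in> uvars t \<Longrightarrow> \<sigma> v \<in> carrier A) \<Longrightarrow> uterm_val A \<sigma> t \<in> carrier A"
proof (induction t)
  case (App f ts)
  then have "length (map (uterm_val A \<sigma>) ts) = ar f" "set (map (uterm_val A \<sigma>) ts) \<subseteq> carrier A"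
    by auto
  then show ?case using assms unfolding is_algebra_def uterm_val.simps by blast
qed simp

text \<open>Variable \<open>i\<close> in \<open>\<tau> g\<close> stands for argument
  \<open>i\<close> of \<open>g\<close>, counted from 0. The bound on the variables keeps evaluation
  under \<open>(!) xs\<close> away from the unspecified entries past the arity.\<close>

definition interpretation_of :: "('f \<Rightarrow> nat) \<Rightarrow> ('g \<Rightarrow> nat) \<Rightarrow> ('g \<Rightarrow> 'f uterm) \<Rightarrow> bool" where
  "interpretation_of ar ar' \<tau> \<longleftrightarrow> (\<forall>g. wf_uterm ar (\<tau> g) \<and> uvars (\<tau> g) \<subseteq> {..<ar' g})"

definition term_reduct :: "('g \<Rightarrow> 'f uterm) \<Rightarrow> ('f, 'a) algebra \<Rightarrow> ('g, 'a) algebra" where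
  "term_reduct \<tau> A = \<lparr>carrier = carrier A, interp = \<lambda>g xs. uterm_val A ((!) xs) (\<tau> g)\<rparr>"

fun translate :: "('g \<Rightarrow> 'f uterm) \<Rightarrow> 'g uterm \<Rightarrow> 'f uterm" where
  "translate \<tau> (Var v) = Var v"
| "translate \<tau> (App g ts) = subst ((!) (map (translate \<tau>) ts)) (\<tau> g)"

lemma carrier_term_reduct [simp]: "carrier (term_reduct \<tau> A) = carrier A"
  by (simp add: term_reduct_def)

lemma interp_term_reduct: "interp (term_reduct \<tau> A) g xs = uterm_val A ((!) xs) (\<tau> g)"
  by (simp add: term_reduct_def)

lemma is_algebra_term_reduct:
  assumes "interpretation_of ar ar' \<tau>" and "is_algebra ar A"
  shows "is_algebra ar' (term_reduct \<tau> A)"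
proof -
  have "uterm_val A ((!) xs) (\<tau> g) \<in> carrier A"
    if "length xs = ar' g" "set xs \<subseteq> carrier A" for g xs
    using assms(2)
  proof (rule uterm_val_closed)
    show "xs ! v \<in> carrier A" if "v \<in> uvars (\<tau> g)" for v
    proof -
      have "v < length xs" using that \<open>length xs = ar' g\<close> assms(1)
        by (auto simp: interpretation_of_def)
      then show ?thesis using \<open>set xs \<subseteq> carrier A\<close> by (meson nth_mem subsetD)
    qed
  qed (use assms(1) in \<open>simp add: interpretation_of_def\<close>)
  then show ?thesis using assms(2) by (simp add: is_algebra_def interp_term_reduct)
qed

lemma wf_translate:
  assumes "interpretation_of ar ar' \<tau>"
  shows "wf_uterm ar' t \<Longrightarrow> wf_uterm ar (translate \<tau> t)"
proof (induction t)
  case (App g ts)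
  have "wf_uterm ar (map (translate \<tau>) ts ! v)" if "v \<in> uvars (\<tau> g)" for v
  proof -
    have "v < length ts" using that App.prems assms by (auto simp: interpretation_of_def)
    then show ?thesis using App by simp
  qed
  then show ?case using assms by (simp add: wf_uterm_subst interpretation_of_def)
qed simp

lemma uterm_val_translate:
  assumes "interpretation_of ar ar' \<tau>"
  shows "wf_uterm ar' t \<Longrightarrow> uterm_val A \<sigma> (translate \<tau> t) = uterm_val (term_reduct \<tau> A) \<sigma> t"
proof (induction t)
  case (App g ts)
  have "uterm_val A \<sigma> (map (translate \<tau>) ts ! v) = map (uterm_val (term_reduct \<tau> A) \<sigma>) ts ! v"
    if "v \<in> uvars (\<tau> g)" for v
  proof -
    have "v < length ts" using that App.prems assms by (auto simp: interpretation_of_def)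
    then show ?thesis using App by simp
  qed
  then have "uterm_val A (\<lambda>v. uterm_val A \<sigma> (map (translate \<tau>) ts ! v)) (\<tau> g) =
      uterm_val A ((!) (map (uterm_val (term_reduct \<tau> A) \<sigma>) ts)) (\<tau> g)"
    by (rule uterm_val_cong_uvars)
  then show ?case by (simp add: uterm_val_subst interp_term_reduct)
qed simp

lemma translate_identities:
  "interpretation_of ar ar' \<tau> \<Longrightarrow> E \<subseteq> identities ar' \<Longrightarrow>
     map_prod (translate \<tau>) (translate \<tau>) ` E \<subseteq> identities ar"
  by (auto simp: identities_def wf_translate)

text \<open>Translating terms and taking reducts run in opposite directions and are adjoint with
  respect to \<open>satisfies\<close>: a translated identity says about \<open>A\<close> what the
  original says about the reduct, on the same universe and under the same valuations.\<close>

lemma models_translate: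
  assumes "interpretation_of ar ar' \<tau>" and "E \<subseteq> identities ar'" and "is_algebra ar A"
  shows "A \<in> models ar (map_prod (translate \<tau>) (translate \<tau>) ` E) \<longleftrightarrow>
    term_reduct \<tau> A \<in> models ar' E"
proof -
  have "satisfies A (map_prod (translate \<tau>) (translate \<tau>) e) \<longleftrightarrow> satisfies (term_reduct \<tau> A) e"
    if "e \<in> E" for e
  proof -
    have "wf_uterm ar' (fst e)" "wf_uterm ar' (snd e)"
      using that assms(2) by (auto simp: identities_def)
    then show ?thesis
      by (simp add: satisfies_def uterm_val_translate[OF assms(1)])
  qed
  then show ?thesis
    using assms(3) is_algebra_term_reduct[OF assms(1,3)] by (simp add: models_def)
qed

lemma agrees_term_reduct:
  assumes "interpretation_of ar ar' \<tau>" and "is_algebra ar A" and "agrees ar A B"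
  shows "agrees ar' (term_reduct \<tau> A) (term_reduct \<tau> B)"
proof -
  have car: "carrier A = carrier B" using assms(3) by (simp add: agrees_def)
  have "uterm_val A ((!) xs) (\<tau> g) = uterm_val B ((!) xs) (\<tau> g)"
    if xs: "length xs = ar' g" "set xs \<subseteq> carrier A" for g xs
  proof -
    obtain a where a: "a \<in> carrier A" using assms(2) by (auto simp: is_algebra_def)
    \<comment> \<open>Agreement applies to valuations that lie in the universe everywhere, which
      \<open>(!) xs\<close> need not do. Past the end of the list an arbitrary element
      \<open>a\<close> fills in; the term \<open>\<tau> g\<close> never looks there.\<close>
    define \<sigma> where "\<sigma> v = (if v < length xs then xs ! v else a)" for v
    have eq: "uterm_val D ((!) xs) (\<tau> g) = uterm_val D \<sigma> (\<tau> g)" for D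
      using assms(1) xs by (intro uterm_val_cong_uvars) (auto simp: interpretation_of_def \<sigma>_def)
    have "range \<sigma> \<subseteq> carrier A" using xs a nth_mem by (fastforce simp: \<sigma>_def)
    then show ?thesis
      unfolding eq using assms
      by (intro agrees_uterm_val[where ar = ar]) (auto simp: interpretation_of_def)
  qed
  then show ?thesis using car by (simp add: agrees_def interp_term_reduct)
qed


section \<open>Term equivalence\<close>

text \<open>The roles are uneven. \<open>V\<close> is given as a variety, whereas \<open>W\<close>
  is pinned down by \<open>W_iff\<close>: the \<open>\<rho>\<close>-reduct lies in \<open>V\<close>,
  and \<open>\<tau>\<close> recovers the operations from it. That \<open>W\<close> is a variety is a
  consequence.\<close>

locale term_equivalence =
  fixes ar :: "'f \<Rightarrow> nat" and ar' :: "'g \<Rightarrow> nat"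
    and \<tau> :: "'g \<Rightarrow> 'f uterm" and \<rho> :: "'f \<Rightarrow> 'g uterm"
    and V :: "('f, 'a) algebra set" and W :: "('g, 'a) algebra set"
  assumes variety_V: "variety ar V"
    and \<tau>: "interpretation_of ar ar' \<tau>"
    and \<rho>: "interpretation_of ar' ar \<rho>"
    and V_agrees: "A \<in> V \<Longrightarrow> agrees ar (term_reduct \<rho> (term_reduct \<tau> A)) A"
    and W_iff: "B \<in> W \<longleftrightarrow> is_algebra ar' B \<and> term_reduct \<rho> B \<in> V \<and>
      agrees ar' (term_reduct \<tau> (term_reduct \<rho> B)) B"
begin

lemma reduct_in_V: "B \<in> W \<Longrightarrow> term_reduct \<rho> B \<in> V"
  by (simp add: W_iff)

lemma reduct_in_W:
  assumes A: "A \<in> V"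
  shows "term_reduct \<tau> A \<in> W"
proof -
  have alg: "is_algebra ar A" using variety_V A by (rule variety_is_algebra)
  then have alg': "is_algebra ar' (term_reduct \<tau> A)" by (rule is_algebra_term_reduct[OF \<tau>])
  then have alg'': "is_algebra ar (term_reduct \<rho> (term_reduct \<tau> A))"
    by (rule is_algebra_term_reduct[OF \<rho>])
  moreover have "term_reduct \<rho> (term_reduct \<tau> A) \<in> V"
    using variety_V A agrees_sym[OF V_agrees[OF A]] by (rule agrees_in_variety)
  \<comment> \<open>Recovering the operations of the \<open>\<tau>\<close>-reduct amounts to
    \<open>V_agrees\<close> with \<open>\<tau>\<close> applied to both sides.\<close>
  ultimately show ?thesis
    using alg' agrees_term_reduct[OF \<tau> alg'' V_agrees[OF A]] by (simp add: W_iff)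
qed

text \<open>
  Membership in \<open>W\<close> needs the identities of \<open>V\<close> translated along \<open>\<rho>\<close>, and in addition that every basic
  operation is recovered from the reduct along \<open>\<rho>\<close>.
\<close>

definition defining_identities :: "'g identity set" where
  "defining_identities = range (\<lambda>g. (App g (map Var [0..<ar' g]), translate \<rho> (\<tau> g)))"

lemma defining_identities: "defining_identities \<subseteq> identities ar'"
  using wf_translate[OF \<rho>] \<tau>
  by (auto simp: defining_identities_def identities_def interpretation_of_def)

lemma models_defining_identities:
  fixes B :: "('g, 'b) algebra"
  assumes B: "is_algebra ar' B"
  shows "B \<in> models ar' defining_identities \<longleftrightarrow> agrees ar' (term_reduct \<tau> (term_reduct \<rho> B)) B"
proof -
  let ?C = "term_reduct \<tau> (term_reduct \<rho> B)"
  have lhs: "uterm_val B \<sigma> (App g (map Var [0..<ar' g])) = interp B g (map \<sigma> [0..<ar' g])" for \<sigma> g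
    by (simp add: comp_def)
  have rhs: "uterm_val B \<sigma> (translate \<rho> (\<tau> g)) = interp ?C g (map \<sigma> [0..<ar' g])" for \<sigma> g
  proof -
    have "uterm_val B \<sigma> (translate \<rho> (\<tau> g)) = uterm_val (term_reduct \<rho> B) \<sigma> (\<tau> g)"
      using \<tau> by (intro uterm_val_translate[OF \<rho>]) (simp add: interpretation_of_def)
    also have "\<dots> = uterm_val (term_reduct \<rho> B) ((!) (map \<sigma> [0..<ar' g])) (\<tau> g)"
    proof (rule uterm_val_cong_uvars)
      fix v assume "v \<in> uvars (\<tau> g)"
      then have "v < ar' g" using \<tau> by (auto simp: interpretation_of_def)
      then show "\<sigma> v = map \<sigma> [0..<ar' g] ! v" by simp
    qed
    finally show ?thesis by (simp add: interp_term_reduct)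
  qed
  obtain b where b: "b \<in> carrier B" using B by (auto simp: is_algebra_def)
  \<comment> \<open>An identity quantifies over valuations of all variables, an agreement over
    argument lists. The two match because every list over the universe extends to a valuation, here
    by the constant \<open>b\<close>.\<close>
  have lists: "(\<forall>\<sigma> :: nat \<Rightarrow> 'b. range \<sigma> \<subseteq> carrier B \<longrightarrow> P (map \<sigma> [0..<n])) \<longleftrightarrow>
      (\<forall>xs. length xs = n \<and> set xs \<subseteq> carrier B \<longrightarrow> P xs)" for P n
  proof (intro iffI allI impI)
    fix xs
    assume *: "\<forall>\<sigma>. range \<sigma> \<subseteq> carrier B \<longrightarrow> P (map \<sigma> [0..<n])"
      and xs: "length xs = n \<and> set xs \<subseteq> carrier B"
    define \<sigma> where "\<sigma> v = (if v < length xs then xs ! v else b)" for v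
    have "range \<sigma> \<subseteq> carrier B" using xs b nth_mem by (fastforce simp: \<sigma>_def)
    moreover have "map \<sigma> [0..<n] = xs" using xs by (intro nth_equalityI) (auto simp: \<sigma>_def)
    ultimately show "P xs" using * by metis
  next
    fix \<sigma> :: "nat \<Rightarrow> 'b"
    assume *: "\<forall>xs. length xs = n \<and> set xs \<subseteq> carrier B \<longrightarrow> P xs" and "range \<sigma> \<subseteq> carrier B"
    then have "set (map \<sigma> [0..<n]) \<subseteq> carrier B" by auto
    then show "P (map \<sigma> [0..<n])" using * by simp
  qed
  have "B \<in> models ar' defining_identities \<longleftrightarrow>
      (\<forall>g \<sigma>. range \<sigma> \<subseteq> carrier B \<longrightarrow>
        interp B g (map \<sigma> [0..<ar' g]) = interp ?C g (map \<sigma> [0..<ar' g]))"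
    using B by (simp add: models_def defining_identities_def satisfies_def rhs lhs
        del: uterm_val.simps)
  also have "\<dots> \<longleftrightarrow> (\<forall>g xs. length xs = ar' g \<and> set xs \<subseteq> carrier B \<longrightarrow>
      interp B g xs = interp ?C g xs)"
    by (simp only: lists[where P = "\<lambda>xs. interp B g xs = interp ?C g xs" for g])
  also have "\<dots> \<longleftrightarrow> agrees ar' ?C B" by (auto simp: agrees_def)
  finally show ?thesis .
qed

lemma variety_reduct_in:
  assumes "variety ar K" and "K \<subseteq> V"
  shows "variety ar' {B \<in> W. term_reduct \<rho> B \<in> K}"
proof -
  obtain E where E: "E \<subseteq> identities ar" "K = models ar E"
    using assms by (auto simp: variety_def)
  let ?F = "map_prod (translate \<rho>) (translate \<rho>) ` E \<union> defining_identities"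
  have "{B \<in> W. term_reduct \<rho> B \<in> K} = models ar' ?F"
  proof (rule Set.set_eqI)
    fix B
    show "B \<in> {B \<in> W. term_reduct \<rho> B \<in> K} \<longleftrightarrow> B \<in> models ar' ?F"
    proof (cases "is_algebra ar' B")
      case True
      then show ?thesis
        using models_translate[OF \<rho> E(1) True] models_defining_identities[OF True] assms(2) E(2)
        by (auto simp: W_iff models_Un)
    qed (simp add: W_iff models_def)
  qed
  moreover have "?F \<subseteq> identities ar'"
    using translate_identities[OF \<rho> E(1)] defining_identities by blast
  ultimately show ?thesis unfolding variety_def by blast
qed

lemma variety_W: "variety ar' W"
proof -
  have "{B \<in> W. term_reduct \<rho> B \<in> V} = W" by (auto simp: reduct_in_V)
  then show ?thesis using variety_reduct_in[OF variety_V] by simp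
qed

text \<open>The counterpart on the side of \<open>V\<close>: the translated identities cut the class
  out inside \<open>V\<close>, which contributes its own axioms.\<close>

lemma variety_reduct_in':
  assumes "variety ar' L"
  shows "variety ar {A \<in> V. term_reduct \<tau> A \<in> L}"
proof -
  obtain E where E: "E \<subseteq> identities ar'" "L = models ar' E"
    using assms by (auto simp: variety_def)
  have "variety ar (models ar (map_prod (translate \<tau>) (translate \<tau>) ` E))"
    using translate_identities[OF \<tau> E(1)] unfolding variety_def by blast
  moreover have "{A \<in> V. term_reduct \<tau> A \<in> L} =
      V \<inter> models ar (map_prod (translate \<tau>) (translate \<tau>) ` E)"
    using models_translate[OF \<tau> E(1)] variety_is_algebra[OF variety_V] E(2) by auto
  ultimately show ?thesis using variety_Int[OF variety_V] by simp
qed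

text \<open>A subvariety \<open>K\<close> of \<open>V\<close> corresponds to the algebras of
  \<open>W\<close> whose \<open>\<rho>\<close>-reduct lies in \<open>K\<close>. Nothing is lost:
  every \<open>A\<close> in \<open>V\<close> agrees with the \<open>\<rho>\<close>-reduct of its own
  \<open>\<tau>\<close>-reduct, so membership of \<open>A\<close> can be tested in
  \<open>W\<close>.\<close>

theorem lattice_isomorphic_subvarieties:
  "lattice_isomorphic (subvariety_lattice ar V) (subvariety_lattice ar' W)"
proof (rule lattice_isomorphicI)
  let ?h = "\<lambda>K. {B \<in> W. term_reduct \<rho> B \<in> K}"
  have retract: "term_reduct \<rho> (term_reduct \<tau> A) \<in> K \<longleftrightarrow> A \<in> K" if "A \<in> V" "variety ar K" for A K
    using V_agrees[OF that(1)] agrees_sym agrees_in_variety[OF that(2)] by blast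
  have refl: "K \<subseteq> L" if KL: "variety ar K" "K \<subseteq> V" "variety ar L" and le: "?h K \<subseteq> ?h L" for K L
  proof
    fix A assume A: "A \<in> K"
    then have AV: "A \<in> V" using KL by blast
    then have "term_reduct \<tau> A \<in> ?h K" using A retract KL reduct_in_W by blast
    then have "term_reduct \<tau> A \<in> ?h L" using le by blast
    then show "A \<in> L" using retract[OF AV KL(3)] by blast
  qed
  show "lattice (subvariety_lattice ar V)" by (rule lattice_subvariety_lattice[OF variety_V])
  show "lattice (subvariety_lattice ar' W)" by (rule lattice_subvariety_lattice[OF variety_W])
  show "?h K \<sqsubseteq>\<^bsub>subvariety_lattice ar' W\<^esub> ?h L \<longleftrightarrow> K \<sqsubseteq>\<^bsub>subvariety_lattice ar V\<^esub> L"
    if "K \<in> carrier (subvariety_lattice ar V)" "L \<in> carrier (subvariety_lattice ar V)" for K L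
  proof
    assume "?h K \<sqsubseteq>\<^bsub>subvariety_lattice ar' W\<^esub> ?h L"
    then show "K \<sqsubseteq>\<^bsub>subvariety_lattice ar V\<^esub> L" using that refl[of K L] by simp
  qed auto
  show "bij_betw ?h (carrier (subvariety_lattice ar V)) (carrier (subvariety_lattice ar' W))"
    unfolding bij_betw_def
  proof
    show "inj_on ?h (carrier (subvariety_lattice ar V))"
    proof (rule inj_onI)
      fix K L
      assume "K \<in> carrier (subvariety_lattice ar V)" "L \<in> carrier (subvariety_lattice ar V)"
        and eq: "?h K = ?h L"
      then show "K = L" using refl[of K L] refl[of L K] by (simp add: subset_antisym)
    qed
    show "?h ` carrier (subvariety_lattice ar V) = carrier (subvariety_lattice ar' W)"
    proof (intro subset_antisym subsetI)
      fix L assume "L \<in> ?h ` carrier (subvariety_lattice ar V)"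
      then show "L \<in> carrier (subvariety_lattice ar' W)" using variety_reduct_in by auto
    next
      fix L assume "L \<in> carrier (subvariety_lattice ar' W)"
      then have L: "variety ar' L" "L \<subseteq> W" by simp_all
      \<comment> \<open>This is the other round trip, from \<open>W\<close> through
        \<open>V\<close>. It exhibits the class of all \<open>A\<close> in \<open>V\<close> with
        \<open>\<tau>\<close>-reduct in \<open>L\<close> as a preimage of \<open>L\<close>.\<close>
      have "B \<in> L \<longleftrightarrow> term_reduct \<tau> (term_reduct \<rho> B) \<in> L" if "B \<in> W" for B
        using that agrees_in_variety[OF L(1)] agrees_sym unfolding W_iff by blast
      then have "L = ?h {A \<in> V. term_reduct \<tau> A \<in> L}" using L(2) reduct_in_V by blast
      moreover have "{A \<in> V. term_reduct \<tau> A \<in> L} \<in> carrier (subvariety_lattice ar V)"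
        using variety_reduct_in'[OF L(1)] by simp
      ultimately show "L \<in> ?h ` carrier (subvariety_lattice ar V)" by (rule image_eqI)
    qed
  qed
qed

end


section \<open>De Morgan algebras\<close>

text \<open>The arity function of the additional operations is left open, so the same facts serve
  all four signatures.\<close>

locale de_morgan_algebra =
  fixes ar :: "'e \<Rightarrow> nat" and A :: "('e dm_op, 'a) algebra"
  assumes alg: "is_algebra (dm_arity ar) A" and reduct: "de_morgan_reduct A"
begin

abbreviation C :: "'a set" where "C \<equiv> carrier A"
abbreviation meet_op (infixl "\<^bold>\<and>" 70) where "meet_op \<equiv> mt A"
abbreviation join_op (infixl "\<^bold>\<or>" 65) where "join_op \<equiv> jn A"
abbreviation neg_op ("\<^bold>\<not> _" [80] 80) where "neg_op \<equiv> ng A"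
abbreviation bot_el ("\<^bold>0") where "bot_el \<equiv> zr A"
abbreviation top_el ("\<^bold>1") where "top_el \<equiv> un A"
abbreviation le_op (infix "\<^bold>\<le>" 50) where "x \<^bold>\<le> y \<equiv> x \<^bold>\<and> y = x"

lemma interp_closed:
  "length xs = dm_arity ar f \<Longrightarrow> set xs \<subseteq> C \<Longrightarrow> interp A f xs \<in> C"
  using alg by (simp add: is_algebra_def)

lemma closed [simp]:
  "x \<in> C \<Longrightarrow> y \<in> C \<Longrightarrow> x \<^bold>\<and> y \<in> C"
  "x \<in> C \<Longrightarrow> y \<in> C \<Longrightarrow> x \<^bold>\<or> y \<in> C"
  "x \<in> C \<Longrightarrow> \<^bold>\<not> x \<in> C"
  "\<^bold>0 \<in> C" "\<^bold>1 \<in> C"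
  by (simp_all add: mt_def jn_def ng_def zr_def un_def interp_closed)

lemma join_comm: "x \<in> C \<Longrightarrow> y \<in> C \<Longrightarrow> x \<^bold>\<or> y = y \<^bold>\<or> x"
  and meet_comm: "x \<in> C \<Longrightarrow> y \<in> C \<Longrightarrow> x \<^bold>\<and> y = y \<^bold>\<and> x"
  and join_meet_absorb: "x \<in> C \<Longrightarrow> y \<in> C \<Longrightarrow> x \<^bold>\<or> (x \<^bold>\<and> y) = x"
  and meet_join_absorb: "x \<in> C \<Longrightarrow> y \<in> C \<Longrightarrow> x \<^bold>\<and> (x \<^bold>\<or> y) = x"
  and meet_join_distrib:
    "x \<in> C \<Longrightarrow> y \<in> C \<Longrightarrow> z \<in> C \<Longrightarrow> x \<^bold>\<and> (y \<^bold>\<or> z) = (x \<^bold>\<and> y) \<^bold>\<or> (x \<^bold>\<and> z)"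
  using reduct unfolding de_morgan_reduct_def by blast+

lemma join_assoc: "x \<in> C \<Longrightarrow> y \<in> C \<Longrightarrow> z \<in> C \<Longrightarrow> (x \<^bold>\<or> y) \<^bold>\<or> z = x \<^bold>\<or> (y \<^bold>\<or> z)"
  and meet_assoc: "x \<in> C \<Longrightarrow> y \<in> C \<Longrightarrow> z \<in> C \<Longrightarrow> (x \<^bold>\<and> y) \<^bold>\<and> z = x \<^bold>\<and> (y \<^bold>\<and> z)"
  using reduct unfolding de_morgan_reduct_def by (blast intro: sym)+

lemma join_zr [simp]: "x \<in> C \<Longrightarrow> x \<^bold>\<or> \<^bold>0 = x"
  and meet_un [simp]: "x \<in> C \<Longrightarrow> x \<^bold>\<and> \<^bold>1 = x"
  and neg_neg [simp]: "x \<in> C \<Longrightarrow> \<^bold>\<not> (\<^bold>\<not> x) = x"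
  and neg_join: "x \<in> C \<Longrightarrow> y \<in> C \<Longrightarrow> \<^bold>\<not> (x \<^bold>\<or> y) = \<^bold>\<not> x \<^bold>\<and> \<^bold>\<not> y"
  and neg_zr [simp]: "\<^bold>\<not> \<^bold>0 = \<^bold>1"
  and neg_un [simp]: "\<^bold>\<not> \<^bold>1 = \<^bold>0"
  using reduct unfolding de_morgan_reduct_def by blast+

section \<open>The lattice order and the antitone negation\<close>

lemma meet_idem [simp]: "x \<in> C \<Longrightarrow> x \<^bold>\<and> x = x"
  using meet_join_absorb[of x "\<^bold>0"] by simp

lemma le_iff_join: "x \<in> C \<Longrightarrow> y \<in> C \<Longrightarrow> x \<^bold>\<le> y \<longleftrightarrow> x \<^bold>\<or> y = y"
  using join_comm[of x y] meet_comm[of x y] join_meet_absorb[of y x] meet_join_absorb[of x y]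
  by auto

lemma le_antisym: "x \<^bold>\<le> y \<Longrightarrow> y \<^bold>\<le> x \<Longrightarrow> x \<in> C \<Longrightarrow> y \<in> C \<Longrightarrow> x = y"
  using meet_comm by metis

lemma le_trans: "x \<^bold>\<le> y \<Longrightarrow> y \<^bold>\<le> z \<Longrightarrow> x \<in> C \<Longrightarrow> y \<in> C \<Longrightarrow> z \<in> C \<Longrightarrow> x \<^bold>\<le> z"
  by (metis meet_assoc)

lemma meet_le1: "x \<in> C \<Longrightarrow> y \<in> C \<Longrightarrow> x \<^bold>\<and> y \<^bold>\<le> x"
  by (metis meet_assoc meet_comm meet_idem closed(1))

lemma meet_le2: "x \<in> C \<Longrightarrow> y \<in> C \<Longrightarrow> x \<^bold>\<and> y \<^bold>\<le> y"
  by (simp add: meet_assoc)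

lemma le_meetI: "z \<^bold>\<le> x \<Longrightarrow> z \<^bold>\<le> y \<Longrightarrow> x \<in> C \<Longrightarrow> y \<in> C \<Longrightarrow> z \<in> C \<Longrightarrow> z \<^bold>\<le> x \<^bold>\<and> y"
  by (metis meet_assoc)

lemma le_join1: "x \<in> C \<Longrightarrow> y \<in> C \<Longrightarrow> x \<^bold>\<le> x \<^bold>\<or> y"
  by (rule meet_join_absorb)

lemma le_join2: "x \<in> C \<Longrightarrow> y \<in> C \<Longrightarrow> y \<^bold>\<le> x \<^bold>\<or> y"
  by (metis join_comm meet_join_absorb)

lemma join_leI: "x \<^bold>\<le> z \<Longrightarrow> y \<^bold>\<le> z \<Longrightarrow> x \<in> C \<Longrightarrow> y \<in> C \<Longrightarrow> z \<in> C \<Longrightarrow> x \<^bold>\<or> y \<^bold>\<le> z"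
  by (simp add: le_iff_join join_assoc)

lemma meet_mono2: "y \<^bold>\<le> z \<Longrightarrow> x \<in> C \<Longrightarrow> y \<in> C \<Longrightarrow> z \<in> C \<Longrightarrow> x \<^bold>\<and> y \<^bold>\<le> x \<^bold>\<and> z"
  by (meson le_meetI le_trans meet_le1 meet_le2 closed(1))

lemma zr_le [simp]: "x \<in> C \<Longrightarrow> \<^bold>0 \<^bold>\<and> x = \<^bold>0"
  using le_join2[of x "\<^bold>0"] by simp

lemma meet_zr [simp]: "x \<in> C \<Longrightarrow> x \<^bold>\<and> \<^bold>0 = \<^bold>0"
  using meet_comm[of x "\<^bold>0"] by simp

lemma join_eq_zr_iff:
  assumes "x \<in> C" "y \<in> C"
  shows "x \<^bold>\<or> y = \<^bold>0 \<longleftrightarrow> x = \<^bold>0 \<and> y = \<^bold>0"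
proof
  assume "x \<^bold>\<or> y = \<^bold>0"
  then show "x = \<^bold>0 \<and> y = \<^bold>0"
    using assms by (metis le_join1 le_join2 meet_zr)
qed simp

lemma le_meet_iff:
  assumes "x \<in> C" "y \<in> C" "z \<in> C"
  shows "z \<^bold>\<le> x \<^bold>\<and> y \<longleftrightarrow> z \<^bold>\<le> x \<and> z \<^bold>\<le> y"
proof
  assume "z \<^bold>\<le> x \<^bold>\<and> y"
  then show "z \<^bold>\<le> x \<and> z \<^bold>\<le> y"
    using assms le_trans[of z "x \<^bold>\<and> y"] meet_le1[of x y] meet_le2[of x y] by simp
qed (use assms le_meetI in simp)

text \<open>Negation is a dual automorphism of the lattice; the dual operations constructed later
  are conjugates by it.\<close>

lemma neg_antimono_iff: "x \<in> C \<Longrightarrow> y \<in> C \<Longrightarrow> \<^bold>\<not> y \<^bold>\<le> \<^bold>\<not> x \<longleftrightarrow> x \<^bold>\<le> y"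
  by (metis closed(2,3) join_comm le_iff_join neg_join neg_neg)

text \<open>Pseudocomplements and implications are known only through the elements below them; this
  is how such knowledge yields uniqueness.\<close>

lemma eq_by_lower:
  assumes "\<And>z. z \<in> C \<Longrightarrow> z \<^bold>\<le> x \<longleftrightarrow> z \<^bold>\<le> y" and "x \<in> C" "y \<in> C"
  shows "x = y"
  using assms le_antisym[of x y] meet_idem by blast

lemma eq_by_upper:
  assumes "\<And>z. z \<in> C \<Longrightarrow> x \<^bold>\<le> z \<longleftrightarrow> y \<^bold>\<le> z" and "x \<in> C" "y \<in> C"
  shows "x = y"
  using assms le_antisym[of x y] meet_idem by blast

lemma join_mono2: "y \<^bold>\<le> z \<Longrightarrow> x \<in> C \<Longrightarrow> y \<in> C \<Longrightarrow> z \<in> C \<Longrightarrow> x \<^bold>\<or> y \<^bold>\<le> x \<^bold>\<or> z"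
  by (meson join_leI le_trans le_join1 le_join2 closed(2))

text \<open>A greatest element of a downward closed set presents that set as a principal ideal. The
  resulting equivalence replaces the two halves of \<open>greatest\<close> in the later
  arguments.\<close>

lemma greatest_iff:
  assumes "S \<subseteq> C" and "\<And>s z. s \<in> S \<Longrightarrow> z \<in> C \<Longrightarrow> z \<^bold>\<le> s \<Longrightarrow> z \<in> S"
  shows "greatest (lattice_order A) g S \<longleftrightarrow> g \<in> C \<and> (\<forall>z\<in>C. z \<^bold>\<le> g \<longleftrightarrow> z \<in> S)"
proof -
  have "greatest (lattice_order A) g S \<longleftrightarrow> g \<in> S \<and> (\<forall>z\<in>S. z \<^bold>\<le> g)"
    using assms(1) by (simp add: greatest_def lattice_order_def)
  also have "\<dots> \<longleftrightarrow> g \<in> C \<and> (\<forall>z\<in>C. z \<^bold>\<le> g \<longleftrightarrow> z \<in> S)"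
    using assms meet_idem[of g] by blast
  finally show ?thesis .
qed

lemma least_iff:
  assumes "S \<subseteq> C" and "\<And>s z. s \<in> S \<Longrightarrow> z \<in> C \<Longrightarrow> s \<^bold>\<le> z \<Longrightarrow> z \<in> S"
  shows "least (lattice_order A) g S \<longleftrightarrow> g \<in> C \<and> (\<forall>z\<in>C. g \<^bold>\<le> z \<longleftrightarrow> z \<in> S)"
proof -
  have "least (lattice_order A) g S \<longleftrightarrow> g \<in> S \<and> (\<forall>z\<in>S. g \<^bold>\<le> z)"
    using assms(1) by (simp add: least_def lattice_order_def)
  also have "\<dots> \<longleftrightarrow> g \<in> C \<and> (\<forall>z\<in>C. g \<^bold>\<le> z \<longleftrightarrow> z \<in> S)"
    using assms meet_idem[of g] by blast
  finally show ?thesis .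
qed

section \<open>Pseudocomplements and implications as equivalences in the order\<close>

lemma is_pcompl_iff:
  "is_pcompl A st \<longleftrightarrow> (\<forall>x\<in>C. st x \<in> C \<and> (\<forall>z\<in>C. z \<^bold>\<le> st x \<longleftrightarrow> x \<^bold>\<and> z = \<^bold>0))"
proof -
  have "greatest (lattice_order A) g {z \<in> C. x \<^bold>\<and> z = \<^bold>0} \<longleftrightarrow>
      g \<in> C \<and> (\<forall>z\<in>C. z \<^bold>\<le> g \<longleftrightarrow> x \<^bold>\<and> z = \<^bold>0)" if x: "x \<in> C" for g x
  proof (subst greatest_iff)
    fix s z assume "s \<in> {z \<in> C. x \<^bold>\<and> z = \<^bold>0}" "z \<in> C" "z \<^bold>\<le> s"
    then show "z \<in> {z \<in> C. x \<^bold>\<and> z = \<^bold>0}" using x meet_mono2[of z s x] by simp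
  qed auto
  then show ?thesis unfolding is_pcompl_def by simp
qed

lemma is_dual_pcompl_iff:
  "is_dual_pcompl A pl \<longleftrightarrow> (\<forall>x\<in>C. pl x \<in> C \<and> (\<forall>z\<in>C. pl x \<^bold>\<le> z \<longleftrightarrow> x \<^bold>\<or> z = \<^bold>1))"
proof -
  have "least (lattice_order A) g {z \<in> C. x \<^bold>\<or> z = \<^bold>1} \<longleftrightarrow>
      g \<in> C \<and> (\<forall>z\<in>C. g \<^bold>\<le> z \<longleftrightarrow> x \<^bold>\<or> z = \<^bold>1)" if x: "x \<in> C" for g x
  proof (subst least_iff)
    fix s z assume "s \<in> {z \<in> C. x \<^bold>\<or> z = \<^bold>1}" "z \<in> C" "s \<^bold>\<le> z"
    then show "z \<in> {z \<in> C. x \<^bold>\<or> z = \<^bold>1}"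
      using x join_mono2[of s z x] meet_comm[of "\<^bold>1" "x \<^bold>\<or> z"] by simp
  qed auto
  then show ?thesis unfolding is_dual_pcompl_def by simp
qed

lemma is_heyting_imp_iff:
  "is_heyting_imp A im \<longleftrightarrow>
    (\<forall>x\<in>C. \<forall>y\<in>C. im x y \<in> C \<and> (\<forall>z\<in>C. z \<^bold>\<le> im x y \<longleftrightarrow> x \<^bold>\<and> z \<^bold>\<le> y))"
proof -
  have "greatest (lattice_order A) g {z \<in> C. x \<^bold>\<and> z \<^bold>\<le> y} \<longleftrightarrow>
      g \<in> C \<and> (\<forall>z\<in>C. z \<^bold>\<le> g \<longleftrightarrow> x \<^bold>\<and> z \<^bold>\<le> y)" if x: "x \<in> C" and y: "y \<in> C" for g x y
  proof (subst greatest_iff)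
    fix s z assume "s \<in> {z \<in> C. x \<^bold>\<and> z \<^bold>\<le> y}" "z \<in> C" "z \<^bold>\<le> s"
    then show "z \<in> {z \<in> C. x \<^bold>\<and> z \<^bold>\<le> y}"
      using x y meet_mono2[of z s x] le_trans[of "x \<^bold>\<and> z" "x \<^bold>\<and> s" y] by simp
  qed auto
  then show ?thesis unfolding is_heyting_imp_def by (simp add: lattice_order_def)
qed

lemma is_dual_heyting_imp_iff:
  "is_dual_heyting_imp A cim \<longleftrightarrow>
    (\<forall>x\<in>C. \<forall>y\<in>C. cim x y \<in> C \<and> (\<forall>z\<in>C. cim x y \<^bold>\<le> z \<longleftrightarrow> y \<^bold>\<le> x \<^bold>\<or> z))"
proof -
  have "least (lattice_order A) g {z \<in> C. y \<^bold>\<le> x \<^bold>\<or> z} \<longleftrightarrow>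
      g \<in> C \<and> (\<forall>z\<in>C. g \<^bold>\<le> z \<longleftrightarrow> y \<^bold>\<le> x \<^bold>\<or> z)" if x: "x \<in> C" and y: "y \<in> C" for g x y
  proof (subst least_iff)
    fix s z assume "s \<in> {z \<in> C. y \<^bold>\<le> x \<^bold>\<or> z}" "z \<in> C" "s \<^bold>\<le> z"
    then show "z \<in> {z \<in> C. y \<^bold>\<le> x \<^bold>\<or> z}"
      using x y join_mono2[of s z x] le_trans[of y "x \<^bold>\<or> s" "x \<^bold>\<or> z"] by simp
  qed auto
  then show ?thesis unfolding is_dual_heyting_imp_def by (simp add: lattice_order_def)
qed

end

section \<open>Derived operations, uniqueness, and identities for the pseudocomplement\<close>

definition dual_star :: "('e dm_op, 'a) algebra \<Rightarrow> ('a \<Rightarrow> 'a) \<Rightarrow> 'a \<Rightarrow> 'a" where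
  "dual_star A st x = ng A (st (ng A x))"

text \<open>Katrinak's term with \<open>dual_star\<close> in the place of the dual pseudocomplement.
  The star is a parameter, so that the formula applies both to a basic star and to
  \<open>x \<rightarrow> 0\<close>.\<close>

definition imp_of :: "('e dm_op, 'a) algebra \<Rightarrow> ('a \<Rightarrow> 'a) \<Rightarrow> 'a \<Rightarrow> 'a \<Rightarrow> 'a" where
  "imp_of A st x y = mt A (st (st (jn A (st x) (st (st y)))))
     (jn A (jn A (dual_star A st (jn A x (st x))) (st x)) (jn A y (st y)))"

definition coimp_of :: "('e dm_op, 'a) algebra \<Rightarrow> ('a \<Rightarrow> 'a) \<Rightarrow> 'a \<Rightarrow> 'a \<Rightarrow> 'a" where
  "coimp_of A st x y = ng A (imp_of A st (ng A x) (ng A y))"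

context de_morgan_algebra
begin

lemma is_pcompl_of_heyting:
  assumes "is_heyting_imp A im"
  shows "is_pcompl A (\<lambda>x. im x \<^bold>0)"
  using assms unfolding is_pcompl_iff is_heyting_imp_iff by (auto 5 2)

lemma is_dual_pcompl_dual_star:
  assumes st: "is_pcompl A st"
  shows "is_dual_pcompl A (dual_star A st)"
  unfolding is_dual_pcompl_iff dual_star_def
proof (intro ballI conjI)
  fix x z assume x: "x \<in> C" and z: "z \<in> C"
  have s: "st (\<^bold>\<not> x) \<in> C" using st x by (simp add: is_pcompl_iff)
  have "\<^bold>\<not> st (\<^bold>\<not> x) \<^bold>\<le> z \<longleftrightarrow> \<^bold>\<not> z \<^bold>\<le> st (\<^bold>\<not> x)"
    using neg_antimono_iff[of "\<^bold>\<not> st (\<^bold>\<not> x)" z] s z by simp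
  also have "\<dots> \<longleftrightarrow> \<^bold>\<not> x \<^bold>\<and> \<^bold>\<not> z = \<^bold>0"
    using st x z by (simp add: is_pcompl_iff)
  also have "\<dots> \<longleftrightarrow> x \<^bold>\<or> z = \<^bold>1"
    using x z by (metis closed(2) neg_join neg_neg neg_un neg_zr)
  finally show "\<^bold>\<not> st (\<^bold>\<not> x) \<^bold>\<le> z \<longleftrightarrow> x \<^bold>\<or> z = \<^bold>1" .
qed (use st in \<open>simp add: is_pcompl_iff\<close>)

lemma is_dual_heyting_imp_neg:
  assumes im: "is_heyting_imp A im"
  shows "is_dual_heyting_imp A (\<lambda>x y. \<^bold>\<not> im (\<^bold>\<not> x) (\<^bold>\<not> y))"
  unfolding is_dual_heyting_imp_iff
proof (intro ballI conjI)
  fix x y z assume x: "x \<in> C" and y: "y \<in> C" and z: "z \<in> C"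
  have i: "im (\<^bold>\<not> x) (\<^bold>\<not> y) \<in> C" using im x y by (simp add: is_heyting_imp_iff)
  have "\<^bold>\<not> im (\<^bold>\<not> x) (\<^bold>\<not> y) \<^bold>\<le> z \<longleftrightarrow> \<^bold>\<not> z \<^bold>\<le> im (\<^bold>\<not> x) (\<^bold>\<not> y)"
    using neg_antimono_iff[of "\<^bold>\<not> im (\<^bold>\<not> x) (\<^bold>\<not> y)" z] i z by simp
  also have "\<dots> \<longleftrightarrow> \<^bold>\<not> x \<^bold>\<and> \<^bold>\<not> z \<^bold>\<le> \<^bold>\<not> y"
    using im x y z by (simp add: is_heyting_imp_iff)
  also have "\<dots> \<longleftrightarrow> y \<^bold>\<le> x \<^bold>\<or> z"
    using neg_antimono_iff[of y "x \<^bold>\<or> z"] x y z by (simp add: neg_join)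
  finally show "\<^bold>\<not> im (\<^bold>\<not> x) (\<^bold>\<not> y) \<^bold>\<le> z \<longleftrightarrow> y \<^bold>\<le> x \<^bold>\<or> z" .
qed (use im in \<open>simp add: is_heyting_imp_iff\<close>)

lemma pcompl_unique: "is_pcompl A st \<Longrightarrow> is_pcompl A st' \<Longrightarrow> x \<in> C \<Longrightarrow> st x = st' x"
  unfolding is_pcompl_iff by (rule eq_by_lower) simp_all

text \<open>With one dual pseudocomplement in hand, the order specification of another becomes a
  family of equations, the form in which \<open>W_iff\<close> can be checked. The next two lemmas do
  the same for the implications.\<close>

lemma is_dual_pcompl_eq_iff:
  "is_dual_pcompl A pl \<Longrightarrow> is_dual_pcompl A pl' \<longleftrightarrow> (\<forall>x\<in>C. pl x = pl' x)"
proof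
  assume "is_dual_pcompl A pl" "is_dual_pcompl A pl'"
  then show "\<forall>x\<in>C. pl x = pl' x"
    unfolding is_dual_pcompl_iff by (intro ballI) (rule eq_by_upper, simp_all)
qed (auto simp: is_dual_pcompl_iff)

lemma is_heyting_imp_eq_iff:
  "is_heyting_imp A im \<Longrightarrow> is_heyting_imp A im' \<longleftrightarrow> (\<forall>x\<in>C. \<forall>y\<in>C. im x y = im' x y)"
proof
  assume "is_heyting_imp A im" "is_heyting_imp A im'"
  then show "\<forall>x\<in>C. \<forall>y\<in>C. im x y = im' x y"
    unfolding is_heyting_imp_iff by (intro ballI) (rule eq_by_lower, simp_all)
qed (auto simp: is_heyting_imp_iff)

lemma is_dual_heyting_imp_eq_iff:
  "is_dual_heyting_imp A im \<Longrightarrow>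
    is_dual_heyting_imp A im' \<longleftrightarrow> (\<forall>x\<in>C. \<forall>y\<in>C. im x y = im' x y)"
proof
  assume "is_dual_heyting_imp A im" "is_dual_heyting_imp A im'"
  then show "\<forall>x\<in>C. \<forall>y\<in>C. im x y = im' x y"
    unfolding is_dual_heyting_imp_iff by (intro ballI) (rule eq_by_upper, simp_all)
qed (auto simp: is_dual_heyting_imp_iff)

text \<open>The second identity carries the maximality: if \<open>x \<and> z = 0\<close>, then
  \<open>z = z \<and> st (x \<and> z) = z \<and> st x\<close>, where the first equality comes from
  \<open>st 0 = 1\<close>.\<close>

lemma is_pcompl_iff_identities:
  assumes clo: "\<And>x. x \<in> C \<Longrightarrow> st x \<in> C"
  shows "is_pcompl A st \<longleftrightarrow>
    (\<forall>x\<in>C. x \<^bold>\<and> st x = \<^bold>0) \<and> (\<forall>x\<in>C. \<forall>y\<in>C. y \<^bold>\<and> st (x \<^bold>\<and> y) = y \<^bold>\<and> st x) \<and> st \<^bold>0 = \<^bold>1"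
    (is "?P \<longleftrightarrow> ?Q")
proof
  assume ?P
  then have iff: "z \<^bold>\<le> st x \<longleftrightarrow> x \<^bold>\<and> z = \<^bold>0" if "x \<in> C" "z \<in> C" for x z
    using that by (simp add: is_pcompl_iff)
  have "y \<^bold>\<and> st (x \<^bold>\<and> y) = y \<^bold>\<and> st x" if xy: "x \<in> C" "y \<in> C" for x y
  proof (rule le_antisym)
    let ?z = "y \<^bold>\<and> st (x \<^bold>\<and> y)"
    have "x \<^bold>\<and> ?z = (x \<^bold>\<and> y) \<^bold>\<and> st (x \<^bold>\<and> y)" using xy clo by (simp add: meet_assoc)
    also have "\<dots> = \<^bold>0" using iff[of "x \<^bold>\<and> y" "st (x \<^bold>\<and> y)"] xy clo by simp
    finally have "?z \<^bold>\<le> st x" using iff xy clo by simp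
    then show "?z \<^bold>\<le> y \<^bold>\<and> st x" using xy clo by (intro le_meetI meet_le1) simp_all
    let ?w = "y \<^bold>\<and> st x"
    have "?w \<^bold>\<le> st x" using xy clo by (intro meet_le2) simp_all
    then have "x \<^bold>\<and> ?w = \<^bold>0" using iff xy clo by simp
    moreover have "(x \<^bold>\<and> y) \<^bold>\<and> ?w = x \<^bold>\<and> ?w"
      using xy clo by (metis closed(1) meet_assoc meet_idem)
    ultimately have "?w \<^bold>\<le> st (x \<^bold>\<and> y)" using iff xy clo by simp
    then show "?w \<^bold>\<le> y \<^bold>\<and> st (x \<^bold>\<and> y)" using xy clo by (intro le_meetI meet_le1) simp_all
  qed (use xy clo in simp_all)
  moreover have "x \<^bold>\<and> st x = \<^bold>0" if "x \<in> C" for x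
    using iff[of x "st x"] that clo by simp
  moreover have "st \<^bold>0 = \<^bold>1"
    using iff[of "\<^bold>0" "\<^bold>1"] clo[of "\<^bold>0"] meet_comm[of "\<^bold>1" "st \<^bold>0"] by simp
  ultimately show ?Q by blast
next
  assume Q: ?Q
  have "z \<^bold>\<le> st x \<longleftrightarrow> x \<^bold>\<and> z = \<^bold>0" if x: "x \<in> C" and z: "z \<in> C" for x z
  proof
    assume "z \<^bold>\<le> st x"
    then have "x \<^bold>\<and> z = x \<^bold>\<and> (st x \<^bold>\<and> z)" using x z clo meet_comm by simp
    also have "\<dots> = (x \<^bold>\<and> st x) \<^bold>\<and> z" using x z clo by (simp add: meet_assoc)
    finally show "x \<^bold>\<and> z = \<^bold>0" using Q x z by simp
  next
    assume "x \<^bold>\<and> z = \<^bold>0"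
    moreover have "z \<^bold>\<and> st (x \<^bold>\<and> z) = z \<^bold>\<and> st x" using Q x z by blast
    ultimately show "z \<^bold>\<le> st x" using Q z by simp
  qed
  then show ?P using clo by (simp add: is_pcompl_iff)
qed

end

section \<open>Katrinak's implication in a regular De Morgan p-algebra\<close>

locale regular_de_morgan_p_algebra = de_morgan_algebra +
  fixes st
  assumes pcompl: "is_pcompl A st" and regular: "regular A st"
begin

lemma star_closed [simp]: "x \<in> C \<Longrightarrow> st x \<in> C"
  using pcompl by (simp add: is_pcompl_iff)

lemma le_star_iff: "x \<in> C \<Longrightarrow> z \<in> C \<Longrightarrow> z \<^bold>\<le> st x \<longleftrightarrow> x \<^bold>\<and> z = \<^bold>0"
  using pcompl by (simp add: is_pcompl_iff)

lemma meet_star [simp]: "x \<in> C \<Longrightarrow> x \<^bold>\<and> st x = \<^bold>0"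
  using le_star_iff[of x "st x"] by simp

lemma star_join:
  assumes "x \<in> C" "y \<in> C"
  shows "st (x \<^bold>\<or> y) = st x \<^bold>\<and> st y"
proof (rule eq_by_lower)
  fix z assume z: "z \<in> C"
  have "z \<^bold>\<le> st (x \<^bold>\<or> y) \<longleftrightarrow> (z \<^bold>\<and> x) \<^bold>\<or> (z \<^bold>\<and> y) = \<^bold>0"
    using assms z meet_comm[of "x \<^bold>\<or> y" z] by (simp add: le_star_iff meet_join_distrib)
  also have "\<dots> \<longleftrightarrow> z \<^bold>\<and> x = \<^bold>0 \<and> z \<^bold>\<and> y = \<^bold>0"
    using assms z by (intro join_eq_zr_iff) simp_all
  also have "\<dots> \<longleftrightarrow> z \<^bold>\<le> st x \<and> z \<^bold>\<le> st y"
    using assms z meet_comm[of z x] meet_comm[of z y] by (simp add: le_star_iff)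
  also have "\<dots> \<longleftrightarrow> z \<^bold>\<le> st x \<^bold>\<and> st y"
    using assms z by (simp add: le_meet_iff)
  finally show "z \<^bold>\<le> st (x \<^bold>\<or> y) \<longleftrightarrow> z \<^bold>\<le> st x \<^bold>\<and> st y" .
qed (use assms in simp_all)

lemma star_star_star [simp]:
  assumes x: "x \<in> C"
  shows "st (st (st x)) = st x"
proof (rule le_antisym)
  have "x \<^bold>\<le> st (st x)" using x meet_comm[of "st x" x] by (simp add: le_star_iff)
  then have "x \<^bold>\<and> st (st (st x)) = (x \<^bold>\<and> st (st x)) \<^bold>\<and> st (st (st x))" by simp
  also have "\<dots> = x \<^bold>\<and> (st (st x) \<^bold>\<and> st (st (st x)))"
    using x by (simp only: meet_assoc star_closed)
  also have "\<dots> = \<^bold>0" using x by simp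
  finally show "st (st (st x)) \<^bold>\<le> st x" using x by (simp add: le_star_iff)
  show "st x \<^bold>\<le> st (st (st x))"
    using x meet_comm[of "st (st x)" "st x"] by (simp add: le_star_iff)
qed (use x in simp_all)

lemma dual_star_closed [simp]: "x \<in> C \<Longrightarrow> dual_star A st x \<in> C"
  by (simp add: dual_star_def)

lemma join_dual_star: "x \<in> C \<Longrightarrow> x \<^bold>\<or> dual_star A st x = \<^bold>1"
  using is_dual_pcompl_dual_star[OF pcompl] meet_idem[of "dual_star A st x"]
  unfolding is_dual_pcompl_iff by blast

text \<open>The regularity condition for double p-algebras, with \<open>dual_star\<close> as the
  dual pseudocomplement; (M1) is its equational form.\<close>

lemma meet_dual_star_le: "x \<in> C \<Longrightarrow> y \<in> C \<Longrightarrow> x \<^bold>\<and> dual_star A st x \<^bold>\<le> y \<^bold>\<or> st y"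
  using regular unfolding regular_def dual_star_def by (subst le_iff_join) simp_all

lemma imp_of_closed [simp]: "x \<in> C \<Longrightarrow> y \<in> C \<Longrightarrow> imp_of A st x y \<in> C"
  by (simp add: imp_of_def)

text \<open>The star of the inner join is \<open>st (st x) \<and> st y\<close>, so the left side
  says that \<open>z\<close> is disjoint from it. Being disjoint from \<open>st (st x)\<close> and
  from \<open>x\<close> is the same because the triple star collapses, which leaves a condition on
  \<open>x \<and> z\<close>.\<close>

lemma le_star_star_iff:
  assumes "x \<in> C" "y \<in> C" "z \<in> C"
  shows "z \<^bold>\<le> st (st (st x \<^bold>\<or> st (st y))) \<longleftrightarrow> (x \<^bold>\<and> z) \<^bold>\<and> st y = \<^bold>0"
proof -
  have "z \<^bold>\<le> st (st (st x \<^bold>\<or> st (st y))) \<longleftrightarrow> st (st x) \<^bold>\<and> (st y \<^bold>\<and> z) = \<^bold>0"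
    using assms by (simp add: star_join le_star_iff meet_assoc)
  also have "\<dots> \<longleftrightarrow> st y \<^bold>\<and> z \<^bold>\<le> st x"
    using assms le_star_iff[of "st (st x)" "st y \<^bold>\<and> z"] by simp
  also have "\<dots> \<longleftrightarrow> x \<^bold>\<and> (st y \<^bold>\<and> z) = \<^bold>0"
    using assms by (simp add: le_star_iff)
  also have "x \<^bold>\<and> (st y \<^bold>\<and> z) = (x \<^bold>\<and> z) \<^bold>\<and> st y"
    using assms meet_comm[of "st y" z] by (simp add: meet_assoc)
  finally show ?thesis .
qed

theorem is_heyting_imp_imp_of: "is_heyting_imp A (imp_of A st)"
  unfolding is_heyting_imp_iff
proof (intro ballI conjI iffI)
  fix x y z assume C: "x \<in> C" "y \<in> C" "z \<in> C"
  let ?d = "dual_star A st (x \<^bold>\<or> st x)"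
  let ?D = "(?d \<^bold>\<or> st x) \<^bold>\<or> (y \<^bold>\<or> st y)"
  let ?S = "st (st (st x \<^bold>\<or> st (st y)))"
  have le_imp: "z \<^bold>\<le> imp_of A st x y \<longleftrightarrow> z \<^bold>\<le> ?S \<and> z \<^bold>\<le> ?D"
    unfolding imp_of_def using C by (intro le_meet_iff) simp_all
  {
    assume "z \<^bold>\<le> imp_of A st x y"
    then have S: "(x \<^bold>\<and> z) \<^bold>\<and> st y = \<^bold>0" and D: "z \<^bold>\<le> ?D"
      using le_imp le_star_star_iff C by auto
    \<comment> \<open>\<open>?d\<close> is the dual pseudocomplement of \<open>x \<or> st x\<close>,
      so regularity has to be applied at that element; hence \<open>x\<close> is first enlarged to
      it.\<close>
    have "x \<^bold>\<and> ?d \<^bold>\<le> x \<^bold>\<or> st x"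
      by (rule le_trans[OF meet_le1 le_join1]) (use C in simp_all)
    then have "x \<^bold>\<and> ?d \<^bold>\<le> (x \<^bold>\<or> st x) \<^bold>\<and> ?d"
      by (rule le_meetI[OF _ meet_le2]) (use C in simp_all)
    then have xd: "x \<^bold>\<and> ?d \<^bold>\<le> y \<^bold>\<or> st y"
      by (rule le_trans[OF _ meet_dual_star_le]) (use C in simp_all)
    have "x \<^bold>\<and> ?D = (x \<^bold>\<and> (?d \<^bold>\<or> st x)) \<^bold>\<or> (x \<^bold>\<and> (y \<^bold>\<or> st y))"
      using C by (intro meet_join_distrib) simp_all
    moreover have "x \<^bold>\<and> (?d \<^bold>\<or> st x) = x \<^bold>\<and> ?d"
      using C by (simp add: meet_join_distrib)
    ultimately have "x \<^bold>\<and> ?D \<^bold>\<le> y \<^bold>\<or> st y"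
      using C xd join_leI[OF xd meet_le2[of x "y \<^bold>\<or> st y"]] by simp
    then have "x \<^bold>\<and> z \<^bold>\<le> y \<^bold>\<or> st y"
      using C D le_trans[OF meet_mono2[OF D, of x]] by simp
    then have "x \<^bold>\<and> z = (x \<^bold>\<and> z) \<^bold>\<and> (y \<^bold>\<or> st y)" by simp
    also have "\<dots> = (x \<^bold>\<and> z) \<^bold>\<and> y" using C S by (simp add: meet_join_distrib)
    finally show "x \<^bold>\<and> z \<^bold>\<le> y" by simp
  next
    assume xz: "x \<^bold>\<and> z \<^bold>\<le> y"
    then have "(x \<^bold>\<and> z) \<^bold>\<and> st y = (x \<^bold>\<and> z) \<^bold>\<and> (y \<^bold>\<and> st y)"
      using C by (metis closed(1) meet_assoc star_closed)
    then have S: "z \<^bold>\<le> ?S" using C le_star_star_iff by simp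
    \<comment> \<open>Maximality of the term: \<open>(x \<or> st x) \<or> ?d = 1\<close> cuts
      \<open>z\<close> into three pieces, and the summands of \<open>?D\<close> bound them,
      \<open>z \<and> x\<close> by \<open>y\<close> and the other two by \<open>st x\<close> and
      \<open>?d\<close>.\<close>
    have "z = z \<^bold>\<and> ((x \<^bold>\<or> st x) \<^bold>\<or> ?d)" using C by (simp add: join_dual_star)
    also have "\<dots> = ((z \<^bold>\<and> x) \<^bold>\<or> (z \<^bold>\<and> st x)) \<^bold>\<or> (z \<^bold>\<and> ?d)"
      using C by (simp add: meet_join_distrib)
    finally have z: "z = ((z \<^bold>\<and> x) \<^bold>\<or> (z \<^bold>\<and> st x)) \<^bold>\<or> (z \<^bold>\<and> ?d)" .
    have "z \<^bold>\<and> x \<^bold>\<le> y \<^bold>\<or> st y"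
      using xz C meet_comm[of x z] le_trans[OF _ le_join1[of y "st y"], of "z \<^bold>\<and> x"] by simp
    then have "z \<^bold>\<and> x \<^bold>\<le> ?D"
      by (rule le_trans[OF _ le_join2]) (use C in simp_all)
    moreover have "z \<^bold>\<and> st x \<^bold>\<le> ?d \<^bold>\<or> st x"
      by (rule le_trans[OF meet_le2 le_join2]) (use C in simp_all)
    then have "z \<^bold>\<and> st x \<^bold>\<le> ?D"
      by (rule le_trans[OF _ le_join1]) (use C in simp_all)
    moreover have "z \<^bold>\<and> ?d \<^bold>\<le> ?d \<^bold>\<or> st x"
      by (rule le_trans[OF meet_le2 le_join1]) (use C in simp_all)
    then have "z \<^bold>\<and> ?d \<^bold>\<le> ?D"
      by (rule le_trans[OF _ le_join1]) (use C in simp_all)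
    ultimately have "((z \<^bold>\<and> x) \<^bold>\<or> (z \<^bold>\<and> st x)) \<^bold>\<or> (z \<^bold>\<and> ?d) \<^bold>\<le> ?D"
      using C by (intro join_leI) simp_all
    then have "z \<^bold>\<le> ?D" using z by metis
    then show "z \<^bold>\<le> imp_of A st x y" using S le_imp by simp
  }
qed simp

text \<open>The term is not computed at \<open>0\<close>: an implication into \<open>0\<close> is a
  pseudocomplement, and pseudocomplements are unique.\<close>

lemma imp_of_zr: "x \<in> C \<Longrightarrow> imp_of A st x \<^bold>0 = st x"
  using is_pcompl_of_heyting[OF is_heyting_imp_imp_of] pcompl by (rule pcompl_unique)

end

section \<open>Order specifications turned into equations with terms\<close>

context de_morgan_algebra
begin

text \<open>The equation alone relates \<open>im\<close> to a term in its own section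
  \<open>im x 0\<close>. The first conjunct ties that section to the order, after which
  \<open>imp_of\<close> is known to be the implication. If the first conjunct fails, so does the
  left side.\<close>

lemma is_heyting_imp_iff_imp_of:
  assumes "regular A (\<lambda>x. im x \<^bold>0)"
  shows "is_heyting_imp A im \<longleftrightarrow>
    is_pcompl A (\<lambda>x. im x \<^bold>0) \<and> (\<forall>x\<in>C. \<forall>y\<in>C. imp_of A (\<lambda>x. im x \<^bold>0) x y = im x y)"
proof (cases "is_pcompl A (\<lambda>x. im x \<^bold>0)")
  case True
  then interpret regular_de_morgan_p_algebra ar A "\<lambda>x. im x \<^bold>0"
    by unfold_locales (use assms in simp_all)
  show ?thesis using True is_heyting_imp_eq_iff[OF is_heyting_imp_imp_of] by simp
qed (use is_pcompl_of_heyting in blast)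

lemma is_dual_heyting_imp_iff_coimp_of:
  assumes "is_pcompl A st" "regular A st"
  shows "is_dual_heyting_imp A cim \<longleftrightarrow> (\<forall>x\<in>C. \<forall>y\<in>C. coimp_of A st x y = cim x y)"
proof -
  interpret regular_de_morgan_p_algebra ar A st by unfold_locales (fact assms)+
  show ?thesis
    unfolding coimp_of_def
    by (rule is_dual_heyting_imp_eq_iff[OF is_dual_heyting_imp_neg[OF is_heyting_imp_imp_of]])
qed

lemma is_dual_pcompl_iff_dual_star:
  "is_pcompl A st \<Longrightarrow> is_dual_pcompl A pl \<longleftrightarrow> (\<forall>x\<in>C. dual_star A st x = pl x)"
  by (rule is_dual_pcompl_eq_iff[OF is_dual_pcompl_dual_star])

end


section \<open>Interpretations fixing the De Morgan operations\<close>

fun extend_op :: "('d \<Rightarrow> 'e dm_op uterm) \<Rightarrow> 'd dm_op \<Rightarrow> 'e dm_op uterm" where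
  "extend_op \<tau> Join = App Join [Var 0, Var 1]"
| "extend_op \<tau> Meet = App Meet [Var 0, Var 1]"
| "extend_op \<tau> Neg = App Neg [Var 0]"
| "extend_op \<tau> Zero = App Zero []"
| "extend_op \<tau> One = App One []"
| "extend_op \<tau> (Op d) = \<tau> d"

lemma interpretation_extend_op:
  assumes "\<And>d. wf_uterm (dm_arity ar) (\<tau> d)" and "\<And>d. uvars (\<tau> d) \<subseteq> {..<ar' d}"
  shows "interpretation_of (dm_arity ar) (dm_arity ar') (extend_op \<tau>)"
  unfolding interpretation_of_def
proof
  fix f show "wf_uterm (dm_arity ar) (extend_op \<tau> f) \<and> uvars (extend_op \<tau> f) \<subseteq> {..<dm_arity ar' f}"
    using assms by (cases f) auto
qed

lemma term_reduct_extend_op [simp]: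
  "jn (term_reduct (extend_op \<tau>) A) = jn A"
  "mt (term_reduct (extend_op \<tau>) A) = mt A"
  "ng (term_reduct (extend_op \<tau>) A) = ng A"
  "zr (term_reduct (extend_op \<tau>) A) = zr A"
  "un (term_reduct (extend_op \<tau>) A) = un A"
  "interp (term_reduct (extend_op \<tau>) A) (Op d) xs = uterm_val A ((!) xs) (\<tau> d)"
  by (simp_all add: fun_eq_iff jn_def mt_def ng_def zr_def un_def interp_term_reduct)

lemma term_reduct_extend_op_dm [simp]:
  "de_morgan_reduct (term_reduct (extend_op \<tau>) A) \<longleftrightarrow> de_morgan_reduct A"
  "is_pcompl (term_reduct (extend_op \<tau>) A) st \<longleftrightarrow> is_pcompl A st"
  "regular (term_reduct (extend_op \<tau>) A) st \<longleftrightarrow> regular A st"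
  "imp_of (term_reduct (extend_op \<tau>) A) = imp_of A"
  "coimp_of (term_reduct (extend_op \<tau>) A) = coimp_of A"
  "dual_star (term_reduct (extend_op \<tau>) A) = dual_star A"
  by (simp_all add: fun_eq_iff de_morgan_reduct_def is_pcompl_def lattice_order_def regular_def
      imp_of_def coimp_of_def dual_star_def)

text \<open>A reduct along \<open>extend_op\<close> has the same De Morgan operations as functions
  on the whole type, so only the additional symbols remain to be compared.\<close>

lemma agrees_dm_iff:
  assumes "carrier A = carrier B" "jn A = jn B" "mt A = mt B" "ng A = ng B" "zr A = zr B" "un A = un B"
  shows "agrees (dm_arity ar) A B \<longleftrightarrow>
    (\<forall>e xs. length xs = ar e \<and> set xs \<subseteq> carrier B \<longrightarrow> interp A (Op e) xs = interp B (Op e) xs)"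
    (is "_ \<longleftrightarrow> ?ops")
proof
  assume ops: ?ops
  have "interp A f xs = interp B f xs" if "length xs = dm_arity ar f" "set xs \<subseteq> carrier B" for f xs
  proof (cases f)
    case Join
    with that obtain x y where "xs = [x, y]" by (auto simp: numeral_2_eq_2 length_Suc_conv)
    then show ?thesis using Join fun_cong[OF fun_cong[OF assms(2)], of x y] by (simp add: jn_def)
  next
    case Meet
    with that obtain x y where "xs = [x, y]" by (auto simp: numeral_2_eq_2 length_Suc_conv)
    then show ?thesis using Meet fun_cong[OF fun_cong[OF assms(3)], of x y] by (simp add: mt_def)
  next
    case Neg
    with that obtain x where "xs = [x]" by (auto simp: length_Suc_conv)
    then show ?thesis using Neg fun_cong[OF assms(4), of x] by (simp add: ng_def)
  next
    case Zero
    then show ?thesis using that assms(5) by (simp add: zr_def)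
  next
    case One
    then show ?thesis using that assms(6) by (simp add: un_def)
  next
    case (Op e)
    then show ?thesis using that ops by simp
  qed
  then show "agrees (dm_arity ar) A B" using assms(1) by (simp add: agrees_def)
qed (auto simp: agrees_def assms(1))

lemma all_lists_1: "(\<forall>xs. length xs = 1 \<and> set xs \<subseteq> S \<longrightarrow> P xs) \<longleftrightarrow> (\<forall>x\<in>S. P [x])"
  by (auto simp: length_Suc_conv)

lemma all_lists_2:
  "(\<forall>xs. length xs = 2 \<and> set xs \<subseteq> S \<longrightarrow> P xs) \<longleftrightarrow> (\<forall>x\<in>S. \<forall>y\<in>S. P [x, y])"
  by (auto simp: numeral_2_eq_2 length_Suc_conv)


section \<open>An equational basis for regular De Morgan p-algebras\<close>

abbreviation "vx \<equiv> Var 0"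
abbreviation "vy \<equiv> Var 1"
abbreviation "vz \<equiv> Var 2"
abbreviation "join_t s t \<equiv> App Join [s, t]"
abbreviation "meet_t s t \<equiv> App Meet [s, t]"
abbreviation "neg_t s \<equiv> App Neg [s]"
abbreviation "zero_t \<equiv> App Zero []"
abbreviation "one_t \<equiv> App One []"
abbreviation "star_t s \<equiv> App (Op Star) [s]"

text \<open>The first fourteen identities match the clauses of \<open>de_morgan_reduct\<close>, the
  next three are those of \<open>is_pcompl_iff_identities\<close>, and the last is (M1).\<close>

definition RDMP_basis :: "p_op dm_op identity set" where
  "RDMP_basis = {
     (join_t vx vy, join_t vy vx), (meet_t vx vy, meet_t vy vx),
     (join_t vx (meet_t vx vy), vx), (meet_t vx (join_t vx vy), vx),
     (join_t vx (join_t vy vz), join_t (join_t vx vy) vz),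
     (meet_t vx (meet_t vy vz), meet_t (meet_t vx vy) vz),
     (meet_t vx (join_t vy vz), join_t (meet_t vx vy) (meet_t vx vz)),
     (join_t vx zero_t, vx), (meet_t vx one_t, vx),
     (neg_t (neg_t vx), vx),
     (neg_t (join_t vx vy), meet_t (neg_t vx) (neg_t vy)),
     (neg_t (meet_t vx vy), join_t (neg_t vx) (neg_t vy)),
     (neg_t zero_t, one_t), (neg_t one_t, zero_t),
     (meet_t vx (star_t vx), zero_t),
     (meet_t vy (star_t (meet_t vx vy)), meet_t vy (star_t vx)),
     (star_t zero_t, one_t),
     (join_t (meet_t vx (neg_t (star_t (neg_t vx)))) (join_t vy (star_t vy)),
      join_t vy (star_t vy))}"

text \<open>The identities of \<open>RDMP_basis\<close> use three variables, so a valuation reduces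
  to three elements, as in the quantifiers of \<open>de_morgan_reduct\<close>. Every index other
  than 0 and 1 receives \<open>z\<close>.\<close>

lemma satisfies_three_vars:
  assumes "uvars s \<subseteq> {0, 1, 2}" "uvars t \<subseteq> {0, 1, 2}"
  shows "satisfies A (s, t) \<longleftrightarrow> (\<forall>x\<in>carrier A. \<forall>y\<in>carrier A. \<forall>z\<in>carrier A.
    uterm_val A (\<lambda>n. if n = 0 then x else if n = 1 then y else z) s =
    uterm_val A (\<lambda>n. if n = 0 then x else if n = 1 then y else z) t)"
    (is "_ \<longleftrightarrow> ?R")
proof
  assume R: ?R
  have "uterm_val A \<sigma> s = uterm_val A \<sigma> t" if "range \<sigma> \<subseteq> carrier A" for \<sigma>
  proof -
    have eq: "uterm_val A (\<lambda>n. if n = 0 then \<sigma> 0 else if n = 1 then \<sigma> 1 else \<sigma> 2) r = uterm_val A \<sigma> r"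
      if "uvars r \<subseteq> {0, 1, 2}" for r
      using that by (intro uterm_val_cong_uvars) auto
    show ?thesis
      using R[rule_format, of "\<sigma> 0" "\<sigma> 1" "\<sigma> 2"] that eq[OF assms(1)] eq[OF assms(2)] by auto
  qed
  then show "satisfies A (s, t)" by (simp add: satisfies_def)
next
  assume sat: "satisfies A (s, t)"
  show ?R
  proof (intro ballI)
    fix x y z assume "x \<in> carrier A" "y \<in> carrier A" "z \<in> carrier A"
    then have "range (\<lambda>n::nat. if n = 0 then x else if n = 1 then y else z) \<subseteq> carrier A" by auto
    then show "uterm_val A (\<lambda>n. if n = 0 then x else if n = 1 then y else z) s =
        uterm_val A (\<lambda>n. if n = 0 then x else if n = 1 then y else z) t"
      using sat by (simp only: satisfies_def fst_conv snd_conv)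
  qed
qed

lemma variety_RDMP: "variety ar_p RDMP"
proof -
  have "RDMP_basis \<subseteq> identities ar_p"
    by (simp add: RDMP_basis_def identities_def ar_p_def)
  moreover have "A \<in> RDMP \<longleftrightarrow> A \<in> models ar_p RDMP_basis" for A :: "(p_op dm_op, 'a) algebra"
  proof (cases "is_algebra ar_p A")
    case alg: True
    let ?st = "\<lambda>x. interp A (Op Star) [x]"
    let ?C = "carrier A"
    \<comment> \<open>A nonempty universe discards the quantifiers over variables that do not occur
      in an identity.\<close>
    have ne: "\<exists>x. x \<in> ?C" using alg by (auto simp: is_algebra_def)
    have clo: "?st x \<in> ?C" if "x \<in> ?C" for x
      using alg that by (simp add: is_algebra_def ar_p_def)
    let ?pc = "(\<forall>x\<in>?C. mt A x (?st x) = zr A) \<and>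
      (\<forall>x\<in>?C. \<forall>y\<in>?C. mt A y (?st (mt A x y)) = mt A y (?st x)) \<and> ?st (zr A) = un A"
    have "(\<forall>e\<in>RDMP_basis. satisfies A e) \<longleftrightarrow> de_morgan_reduct A \<and> ?pc \<and> regular A ?st"
      by (simp add: RDMP_basis_def satisfies_three_vars de_morgan_reduct_def regular_def
          jn_def mt_def ng_def zr_def un_def ne ball_conj_distrib conj_ac)
    \<comment> \<open>The equational form of the pseudocomplement rests on the lattice laws, so the
      equivalence is claimed under \<open>de_morgan_reduct A\<close>.\<close>
    moreover have "?pc \<longleftrightarrow> is_pcompl A ?st" if "de_morgan_reduct A"
    proof -
      interpret de_morgan_algebra "\<lambda>_. 1" A
        using alg that by unfold_locales (simp_all add: ar_p_def)
      show ?thesis using is_pcompl_iff_identities[of ?st, OF clo] by simp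
    qed
    ultimately have "(\<forall>e\<in>RDMP_basis. satisfies A e) \<longleftrightarrow>
        de_morgan_reduct A \<and> is_pcompl A ?st \<and> regular A ?st" by argo
    then show ?thesis using alg by (simp only: RDMP_def models_def mem_Collect_eq simp_thms)
  qed (simp add: RDMP_def models_def)
  ultimately show ?thesis unfolding variety_def by blast
qed


section \<open>The term equivalences\<close>

definition dual_star_term :: "p_op dm_op uterm \<Rightarrow> p_op dm_op uterm" where
  "dual_star_term s = neg_t (star_t (neg_t s))"

definition imp_term :: "p_op dm_op uterm \<Rightarrow> p_op dm_op uterm \<Rightarrow> p_op dm_op uterm" where
  "imp_term s t = meet_t (star_t (star_t (join_t (star_t s) (star_t (star_t t)))))
     (join_t (join_t (dual_star_term (join_t s (star_t s))) (star_t s)) (join_t t (star_t t)))"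

definition coimp_term :: "p_op dm_op uterm \<Rightarrow> p_op dm_op uterm \<Rightarrow> p_op dm_op uterm" where
  "coimp_term s t = neg_t (imp_term (neg_t s) (neg_t t))"

lemma uterm_val_terms [simp]:
  "uterm_val A \<sigma> (dual_star_term s) = dual_star A (\<lambda>x. interp A (Op Star) [x]) (uterm_val A \<sigma> s)"
  "uterm_val A \<sigma> (imp_term s t) =
    imp_of A (\<lambda>x. interp A (Op Star) [x]) (uterm_val A \<sigma> s) (uterm_val A \<sigma> t)"
  "uterm_val A \<sigma> (coimp_term s t) =
    coimp_of A (\<lambda>x. interp A (Op Star) [x]) (uterm_val A \<sigma> s) (uterm_val A \<sigma> t)"
  by (simp_all add: dual_star_term_def imp_term_def coimp_term_def dual_star_def imp_of_def
      coimp_of_def jn_def mt_def ng_def)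

lemma wf_terms [simp]:
  "wf_uterm (dm_arity (\<lambda>_. Suc 0)) (dual_star_term s) \<longleftrightarrow> wf_uterm (dm_arity (\<lambda>_. Suc 0)) s"
  "wf_uterm (dm_arity (\<lambda>_. Suc 0)) (imp_term s t) \<longleftrightarrow>
    wf_uterm (dm_arity (\<lambda>_. Suc 0)) s \<and> wf_uterm (dm_arity (\<lambda>_. Suc 0)) t"
  "wf_uterm (dm_arity (\<lambda>_. Suc 0)) (coimp_term s t) \<longleftrightarrow>
    wf_uterm (dm_arity (\<lambda>_. Suc 0)) s \<and> wf_uterm (dm_arity (\<lambda>_. Suc 0)) t"
  by (auto simp: dual_star_term_def imp_term_def coimp_term_def)

lemma uvars_terms [simp]:
  "uvars (dual_star_term s) = uvars s"
  "uvars (imp_term s t) = uvars s \<union> uvars t"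
  "uvars (coimp_term s t) = uvars s \<union> uvars t"
  by (auto simp: dual_star_term_def imp_term_def coimp_term_def)

fun h_to_p :: "h_op \<Rightarrow> p_op dm_op uterm" where
  "h_to_p Imp = imp_term vx vy"

fun p_to_h :: "p_op \<Rightarrow> h_op dm_op uterm" where
  "p_to_h Star = App (Op Imp) [vx, zero_t]"

fun dblh_to_p :: "dblh_op \<Rightarrow> p_op dm_op uterm" where
  "dblh_to_p DImp = imp_term vx vy"
| "dblh_to_p DCoimp = coimp_term vx vy"

fun p_to_dblh :: "p_op \<Rightarrow> dblh_op dm_op uterm" where
  "p_to_dblh Star = App (Op DImp) [vx, zero_t]"

fun dblp_to_p :: "dblp_op \<Rightarrow> p_op dm_op uterm" where
  "dblp_to_p DStar = star_t vx"
| "dblp_to_p DPlus = dual_star_term vx"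

fun p_to_dblp :: "p_op \<Rightarrow> dblp_op dm_op uterm" where
  "p_to_dblp Star = App (Op DStar) [vx]"

lemma all_ops:
  "(\<forall>e. P e) \<longleftrightarrow> P Star" "(\<forall>e. Q e) \<longleftrightarrow> Q Imp"
  "(\<forall>e. R e) \<longleftrightarrow> R DImp \<and> R DCoimp" "(\<forall>e. S e) \<longleftrightarrow> S DStar \<and> S DPlus"
  by (metis p_op.exhaust, metis h_op.exhaust, metis dblh_op.exhaust, metis dblp_op.exhaust)

lemma RDMP_imp_of_zr:
  assumes "A \<in> RDMP" and "x \<in> carrier A"
  shows "imp_of A (\<lambda>x. interp A (Op Star) [x]) x (zr A) = interp A (Op Star) [x]"
proof -
  interpret regular_de_morgan_p_algebra "\<lambda>_. 1" A "\<lambda>x. interp A (Op Star) [x]"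
    using assms(1) by unfold_locales (simp_all add: RDMP_def ar_p_def)
  show ?thesis using assms(2) by (rule imp_of_zr)
qed

text \<open>Once unfolded, \<open>W_iff\<close> is \<open>is_heyting_imp_iff_imp_of\<close> with
  regularity added on both sides, and the round trip on \<open>RDMP\<close> is the evaluation of
  \<open>imp_of\<close> at \<open>0\<close>.\<close>

lemma term_equivalence_RDMH:
  "term_equivalence ar_p ar_h (extend_op h_to_p) (extend_op p_to_h) RDMP
     (RDMH :: (h_op dm_op, 'a) algebra set)"
proof
  show "variety ar_p (RDMP :: (p_op dm_op, 'a) algebra set)" by (rule variety_RDMP)
  show "interpretation_of ar_p ar_h (extend_op h_to_p)"
    unfolding ar_p_def ar_h_def
  proof (rule interpretation_extend_op)
    show "wf_uterm (dm_arity (\<lambda>_. 1)) (h_to_p d)" "uvars (h_to_p d) \<subseteq> {..<2}" for d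
      by (cases d; simp)+
  qed
  show \<rho>: "interpretation_of ar_h ar_p (extend_op p_to_h)"
    unfolding ar_p_def ar_h_def
  proof (rule interpretation_extend_op)
    show "wf_uterm (dm_arity (\<lambda>_. 2)) (p_to_h d)" "uvars (p_to_h d) \<subseteq> {..<1}" for d
      by (cases d; simp)+
  qed
  show "agrees ar_p (term_reduct (extend_op p_to_h) (term_reduct (extend_op h_to_p) A)) A"
    if "A \<in> RDMP" for A :: "(p_op dm_op, 'a) algebra"
    unfolding ar_p_def
    by (subst agrees_dm_iff)
      (simp_all only: carrier_term_reduct term_reduct_extend_op all_ops all_lists_1,
       simp add: RDMP_imp_of_zr[OF that] zr_def[symmetric])
  show "B \<in> RDMH \<longleftrightarrow> is_algebra ar_h B \<and> term_reduct (extend_op p_to_h) B \<in> RDMP \<and>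
      agrees ar_h (term_reduct (extend_op h_to_p) (term_reduct (extend_op p_to_h) B)) B"
    for B :: "(h_op dm_op, 'a) algebra"
  proof (cases "is_algebra ar_h B \<and> de_morgan_reduct B")
    case True
    let ?im = "\<lambda>x y. interp B (Op Imp) [x, y]"
    let ?st = "\<lambda>x. ?im x (zr B)"
    interpret de_morgan_algebra "\<lambda>_. 2" B using True by unfold_locales (simp_all add: ar_h_def)
    have "term_reduct (extend_op p_to_h) B \<in> RDMP \<longleftrightarrow> is_pcompl B ?st \<and> regular B ?st"
      using True is_algebra_term_reduct[OF \<rho>, of B] by (simp add: RDMP_def zr_def)
    moreover have "agrees ar_h (term_reduct (extend_op h_to_p) (term_reduct (extend_op p_to_h) B)) B
        \<longleftrightarrow> (\<forall>x\<in>C. \<forall>y\<in>C. imp_of B ?st x y = ?im x y)"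
      unfolding ar_h_def
      by (subst agrees_dm_iff)
        (simp_all only: carrier_term_reduct term_reduct_extend_op all_ops all_lists_2, simp add: zr_def)
    ultimately show ?thesis
      using True is_heyting_imp_iff_imp_of[of ?im] by (auto simp: RDMH_def)
  qed (auto simp: RDMH_def RDMP_def)
qed

text \<open>As for \<open>RDMH\<close>, with one more equation: when the reduct lies in
  \<open>RDMP\<close>, the order condition on the dual implication amounts to agreement with
  \<open>coimp_of\<close>.\<close>

lemma term_equivalence_RDMDBLH:
  "term_equivalence ar_p ar_dblh (extend_op dblh_to_p) (extend_op p_to_dblh) RDMP
     (RDMDBLH :: (dblh_op dm_op, 'a) algebra set)"
proof
  show "variety ar_p (RDMP :: (p_op dm_op, 'a) algebra set)" by (rule variety_RDMP)
  show "interpretation_of ar_p ar_dblh (extend_op dblh_to_p)"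
    unfolding ar_p_def ar_dblh_def
  proof (rule interpretation_extend_op)
    show "wf_uterm (dm_arity (\<lambda>_. 1)) (dblh_to_p d)" "uvars (dblh_to_p d) \<subseteq> {..<2}" for d
      by (cases d; simp)+
  qed
  show \<rho>: "interpretation_of ar_dblh ar_p (extend_op p_to_dblh)"
    unfolding ar_p_def ar_dblh_def
  proof (rule interpretation_extend_op)
    show "wf_uterm (dm_arity (\<lambda>_. 2)) (p_to_dblh d)" "uvars (p_to_dblh d) \<subseteq> {..<1}" for d
      by (cases d; simp)+
  qed
  show "agrees ar_p (term_reduct (extend_op p_to_dblh) (term_reduct (extend_op dblh_to_p) A)) A"
    if "A \<in> RDMP" for A :: "(p_op dm_op, 'a) algebra"
    unfolding ar_p_def
    by (subst agrees_dm_iff)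
      (simp_all only: carrier_term_reduct term_reduct_extend_op all_ops all_lists_1,
       simp add: RDMP_imp_of_zr[OF that] zr_def[symmetric])
  show "B \<in> RDMDBLH \<longleftrightarrow> is_algebra ar_dblh B \<and> term_reduct (extend_op p_to_dblh) B \<in> RDMP \<and>
      agrees ar_dblh (term_reduct (extend_op dblh_to_p) (term_reduct (extend_op p_to_dblh) B)) B"
    for B :: "(dblh_op dm_op, 'a) algebra"
  proof (cases "is_algebra ar_dblh B \<and> de_morgan_reduct B")
    case True
    let ?im = "\<lambda>x y. interp B (Op DImp) [x, y]"
    let ?cim = "\<lambda>x y. interp B (Op DCoimp) [x, y]"
    let ?st = "\<lambda>x. ?im x (zr B)"
    interpret de_morgan_algebra "\<lambda>_. 2" B using True by unfold_locales (simp_all add: ar_dblh_def)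
    have "term_reduct (extend_op p_to_dblh) B \<in> RDMP \<longleftrightarrow> is_pcompl B ?st \<and> regular B ?st"
      using True is_algebra_term_reduct[OF \<rho>, of B] by (simp add: RDMP_def zr_def)
    moreover have
      "agrees ar_dblh (term_reduct (extend_op dblh_to_p) (term_reduct (extend_op p_to_dblh) B)) B
        \<longleftrightarrow> (\<forall>x\<in>C. \<forall>y\<in>C. imp_of B ?st x y = ?im x y) \<and>
            (\<forall>x\<in>C. \<forall>y\<in>C. coimp_of B ?st x y = ?cim x y)"
      unfolding ar_dblh_def
      by (subst agrees_dm_iff)
        (simp_all only: carrier_term_reduct term_reduct_extend_op all_ops all_lists_2, simp add: zr_def)
    ultimately show ?thesis
      using True is_heyting_imp_iff_imp_of[of ?im] is_dual_heyting_imp_iff_coimp_of[of ?st ?cim]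
      by (auto simp: RDMDBLH_def)
  qed (auto simp: RDMDBLH_def RDMP_def)
qed

text \<open>The star is basic on both sides and returns literally after a round trip. What has to be
  recovered is the plus, which is \<open>dual_star\<close> by uniqueness.\<close>

lemma term_equivalence_RDMDBLP:
  "term_equivalence ar_p ar_dblp (extend_op dblp_to_p) (extend_op p_to_dblp) RDMP
     (RDMDBLP :: (dblp_op dm_op, 'a) algebra set)"
proof
  show "variety ar_p (RDMP :: (p_op dm_op, 'a) algebra set)" by (rule variety_RDMP)
  show "interpretation_of ar_p ar_dblp (extend_op dblp_to_p)"
    unfolding ar_p_def ar_dblp_def
  proof (rule interpretation_extend_op)
    show "wf_uterm (dm_arity (\<lambda>_. 1)) (dblp_to_p d)" "uvars (dblp_to_p d) \<subseteq> {..<1}" for d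
      by (cases d; simp)+
  qed
  show \<rho>: "interpretation_of ar_dblp ar_p (extend_op p_to_dblp)"
    unfolding ar_p_def ar_dblp_def
  proof (rule interpretation_extend_op)
    show "wf_uterm (dm_arity (\<lambda>_. 1)) (p_to_dblp d)" "uvars (p_to_dblp d) \<subseteq> {..<1}" for d
      by (cases d; simp)+
  qed
  show "agrees ar_p (term_reduct (extend_op p_to_dblp) (term_reduct (extend_op dblp_to_p) A)) A"
    for A :: "(p_op dm_op, 'a) algebra"
    unfolding ar_p_def
    by (subst agrees_dm_iff)
      (simp_all only: carrier_term_reduct term_reduct_extend_op all_ops all_lists_1, simp)
  show "B \<in> RDMDBLP \<longleftrightarrow> is_algebra ar_dblp B \<and> term_reduct (extend_op p_to_dblp) B \<in> RDMP \<and>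
      agrees ar_dblp (term_reduct (extend_op dblp_to_p) (term_reduct (extend_op p_to_dblp) B)) B"
    for B :: "(dblp_op dm_op, 'a) algebra"
  proof (cases "is_algebra ar_dblp B \<and> de_morgan_reduct B")
    case True
    let ?st = "\<lambda>x. interp B (Op DStar) [x]"
    let ?pl = "\<lambda>x. interp B (Op DPlus) [x]"
    interpret de_morgan_algebra "\<lambda>_. 1" B using True by unfold_locales (simp_all add: ar_dblp_def)
    have "term_reduct (extend_op p_to_dblp) B \<in> RDMP \<longleftrightarrow> is_pcompl B ?st \<and> regular B ?st"
      using True is_algebra_term_reduct[OF \<rho>, of B] by (simp add: RDMP_def)
    moreover have
      "agrees ar_dblp (term_reduct (extend_op dblp_to_p) (term_reduct (extend_op p_to_dblp) B)) B
        \<longleftrightarrow> (\<forall>x\<in>C. dual_star B ?st x = ?pl x)"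
      unfolding ar_dblp_def
      by (subst agrees_dm_iff)
        (simp_all only: carrier_term_reduct term_reduct_extend_op all_ops all_lists_1, simp)
    ultimately show ?thesis
      using True is_dual_pcompl_iff_dual_star[of ?st ?pl] by (auto simp: RDMDBLP_def)
  qed (auto simp: RDMDBLP_def RDMP_def)
qed

theorem corollary2p11:
  shows "lattice_isomorphic
           (subvariety_lattice ar_p (RDMP :: (p_op dm_op, 'u) algebra set))
           (subvariety_lattice ar_h (RDMH :: (h_op dm_op, 'u) algebra set)) \<and>
         lattice_isomorphic
           (subvariety_lattice ar_h (RDMH :: (h_op dm_op, 'u) algebra set))
           (subvariety_lattice ar_dblh (RDMDBLH :: (dblh_op dm_op, 'u) algebra set)) \<and>
         lattice_isomorphic
           (subvariety_lattice ar_dblh (RDMDBLH :: (dblh_op dm_op, 'u) algebra set))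
           (subvariety_lattice ar_dblp (RDMDBLP :: (dblp_op dm_op, 'u) algebra set))"
proof -
  note H = term_equivalence.lattice_isomorphic_subvarieties[OF term_equivalence_RDMH]
    and DH = term_equivalence.lattice_isomorphic_subvarieties[OF term_equivalence_RDMDBLH]
    and DP = term_equivalence.lattice_isomorphic_subvarieties[OF term_equivalence_RDMDBLP]
  show ?thesis
    using H lattice_isomorphic_trans[OF lattice_isomorphic_sym[OF H] DH]
      lattice_isomorphic_trans[OF lattice_isomorphic_sym[OF DH] DP] by blast
qed

end
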